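(* Let $U$ be a steady self-similar entropy solution of the two-dimensional full Euler equations (with values in $\mathcal P_K$), and suppose $U$ has a shock at $\theta_0$. Then there exist $\sigma^+(\theta_0)>\theta_0$ and $\sigma^-(\theta_0)<\theta_0$ such that $U$ is constant on $]\sigma^-(\theta_0),\theta_0[$ and constant on $]\theta_0,\sigma^+(\theta_0)[$. In particular, $U$ has well-defined left and right limits at shocks.
   Context: Notation: $\rho$ density, $\tau=1/\rho$, $\vec u=(u,v)$ velocity, $p$ pressure, $e$ specific internal energy, $S$ specific entropy, $T>0$ temperature, $E=\rho\left(\frac{u^2+v^2}{2}+e\right)$, $U=(\rho,\rho u,\rho v,E)^T$. Any two of $p,T,\tau,e,S$ determine the others. Phase space: for a constant $K>1$, $\mathcal P_K$ is the set of $U$ with $K^{-1}\le\rho\le K$, $K^{-1}\le e\le K$, $|U|\le K$. Equation of state: $p=g(\tau,S)$, smooth on the phase space, with $g_\tau=-\rho^2c^2<0$ (this defines the sound speed $c>0$), $g_{\tau\tau}>0$, $g_S>0$, and $(\partial e/\partial\tau)_S=-p$, $(\partial e/\partial S)_\tau=T$. It is also assumed that for each fixed state $(\tau_+,p_+)$ the set of $(\tau,p)$ with $e(\tau,p)-e(\tau_+,p_+)+\frac12(\tau-\tau_+)(p+p_+)=0$ is a smooth curve of the form $p=G(\tau)$. Fluxes: $f^x(U)=(\rho u,\rho u^2+p,\rho uv,u(E+p))^T$, $f^y(U)=(\rho v,\rho uv,\rho v^2+p,v(E+p))^T$, $\psi^x=\rho uS$, $\psi^y=\rho vS$. A steady self-similar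 entropy solution is a $2\pi$-periodic function $\theta\mapsto U(\theta)\in\mathcal P_K$ in $L^\infty$ ($\theta$ is the polar angle), in a version such that for all $\theta_1<\theta_2$ $$(\sin\theta f^x(U)-\cos\theta f^y(U))\big|_{\theta_1}^{\theta_2}=\int_{\theta_1}^{\theta_2}\cos\eta f^x(U(\eta))+\sin\eta f^y(U(\eta))\,d\eta,$$ $$(\sin\theta\psi^x(U)-\cos\theta\psi^y(U))\big|_{\theta_1}^{\theta_2}\le\int_{\theta_1}^{\theta_2}\cos\eta\psi^x(U(\eta))+\sin\eta\psi^y(U(\eta))\,d\eta.$$ Normal velocity: $N(\theta)=u(\theta)\sin\theta-v(\theta)\cos\theta$. If $U$ is discontinuous at $\theta_0$, it has a forward facing shock there if $N>0$ on a neighborhood of $\theta_0$, and a backward facing shock if $N<0$ on a neighborhood of $\theta_0$. A shock is a forward or backward facing shock. *)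

theory Defs
  imports "HOL-Analysis.Analysis"
begin

fun Ck_on :: "nat \<Rightarrow> 'a::real_normed_vector set \<Rightarrow> ('a \<Rightarrow> 'b::real_normed_vector) \<Rightarrow> bool" where
  "Ck_on 0 A f \<longleftrightarrow> continuous_on A f"
| "Ck_on (Suc k) A f \<longleftrightarrow>
     (\<forall>x\<in>A. f differentiable (at x)) \<and> (\<forall>v. Ck_on k A (\<lambda>x. frechet_derivative f (at x) v))"

(* Only meaningful for open A. *)
definition smooth_on :: "'a::real_normed_vector set \<Rightarrow> ('a \<Rightarrow> 'b::real_normed_vector) \<Rightarrow> bool" where
  "smooth_on A f \<longleftrightarrow> (\<forall>k. Ck_on k A f)"


section \<open>States and thermodynamics\<close>

(* U = (rho, rho u, rho v, E); the product norm is the Euclidean norm. *)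
type_synonym state = "real \<times> real \<times> real \<times> real"

definition density :: "state \<Rightarrow> real" where
  "density U = fst U"

definition vel_x :: "state \<Rightarrow> real" where
  "vel_x U = fst (snd U) / density U"

definition vel_y :: "state \<Rightarrow> real" where
  "vel_y U = fst (snd (snd U)) / density U"

definition total_energy :: "state \<Rightarrow> real" where
  "total_energy U = snd (snd (snd U))"

(* Solved from E = rho ((u^2 + v^2)/2 + e). *)
definition internal_energy :: "state \<Rightarrow> real" where
  "internal_energy U = total_energy U / density U - ((vel_x U)\<^sup>2 + (vel_y U)\<^sup>2) / 2"

definition spec_vol :: "state \<Rightarrow> real" where
  "spec_vol U = 1 / density U"

definition phase_space :: "real \<Rightarrow> state set" where
  "phase_space K = {U. 1 / K \<le> density U \<and> density U \<le> K \<and>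
     1 / K \<le> internal_energy U \<and> internal_energy U \<le> K \<and> norm U \<le> K}"

(* Pressure, internal energy and temperature as functions of specific volume and specific
   entropy, on a set of thermodynamic states (tau, S). Smoothness and the sign conditions are
   required on this set, which is open and contains the states occurring in the phase space. *)
record eos =
  eos_states :: "(real \<times> real) set"
  eos_pressure :: "real \<Rightarrow> real \<Rightarrow> real"
  eos_energy :: "real \<Rightarrow> real \<Rightarrow> real"
  eos_temperature :: "real \<Rightarrow> real \<Rightarrow> real"

(* A subset of the (tau, p) plane. By injectivity of (tau, S) |-> (tau, p) in admissible_eos,
   e(tau, p) is e(tau, s) for the unique s with pressure p. *)
definition hugoniot_locus :: "eos \<Rightarrow> real \<Rightarrow> real \<Rightarrow> (real \<times> real) set" where
  "hugoniot_locus M \<tau>\<^sub>0 s\<^sub>0 =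
     {(\<tau>, eos_pressure M \<tau> s) | \<tau> s. (\<tau>, s) \<in> eos_states M \<and>
        eos_energy M \<tau> s - eos_energy M \<tau>\<^sub>0 s\<^sub>0
          + (1/2) * (\<tau> - \<tau>\<^sub>0) * (eos_pressure M \<tau> s + eos_pressure M \<tau>\<^sub>0 s\<^sub>0) = 0}"

(* Of the interchangeability of the variables p, T, tau, e, S only the pairs actually used as
   coordinates are required: (tau, S), (tau, e), (tau, p). Requiring it for all pairs would
   exclude polytropic gases, where e is a function of T alone.
   The condition p_tau < 0 is p_tau = - rho^2 c^2 with sound speed c > 0. *)
definition admissible_eos :: "real \<Rightarrow> eos \<Rightarrow> bool" where
  "admissible_eos K M \<longleftrightarrow>
     open (eos_states M) \<and>
     (\<forall>U \<in> phase_space K. \<exists>s. (spec_vol U, s) \<in> eos_states M \<and>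
        eos_energy M (spec_vol U) s = internal_energy U) \<and>
     inj_on (\<lambda>(\<tau>, s). (\<tau>, eos_energy M \<tau> s)) (eos_states M) \<and>
     inj_on (\<lambda>(\<tau>, s). (\<tau>, eos_pressure M \<tau> s)) (eos_states M) \<and>
     smooth_on (eos_states M) (\<lambda>(\<tau>, s). eos_pressure M \<tau> s) \<and>
     smooth_on (eos_states M) (\<lambda>(\<tau>, s). eos_energy M \<tau> s) \<and>
     (\<forall>(\<tau>, s) \<in> eos_states M.
        deriv (\<lambda>t. eos_pressure M t s) \<tau> < 0 \<and>
        deriv (deriv (\<lambda>t. eos_pressure M t s)) \<tau> > 0 \<and>
        deriv (\<lambda>r. eos_pressure M \<tau> r) s > 0 \<and>
        ((\<lambda>t. eos_energy M t s) has_real_derivative - eos_pressure M \<tau> s) (at \<tau>) \<and>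
        ((\<lambda>r. eos_energy M \<tau> r) has_real_derivative eos_temperature M \<tau> s) (at s) \<and>
        eos_temperature M \<tau> s > 0) \<and>
     (\<forall>(\<tau>\<^sub>0, s\<^sub>0) \<in> eos_states M. \<exists>I G. open I \<and> is_interval I \<and> smooth_on I G \<and>
        hugoniot_locus M \<tau>\<^sub>0 s\<^sub>0 = {(\<tau>, G \<tau>) | \<tau>. \<tau> \<in> I})"

definition entropy :: "eos \<Rightarrow> state \<Rightarrow> real" where
  "entropy M U = (THE s. (spec_vol U, s) \<in> eos_states M \<and>
     eos_energy M (spec_vol U) s = internal_energy U)"

definition pressure :: "eos \<Rightarrow> state \<Rightarrow> real" where
  "pressure M U = eos_pressure M (spec_vol U) (entropy M U)"


section \<open>Steady self-similar Euler flow\<close>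

definition flux_x :: "eos \<Rightarrow> state \<Rightarrow> state" where
  "flux_x M U =
     (density U * vel_x U,
      density U * (vel_x U)\<^sup>2 + pressure M U,
      density U * vel_x U * vel_y U,
      vel_x U * (total_energy U + pressure M U))"

definition flux_y :: "eos \<Rightarrow> state \<Rightarrow> state" where
  "flux_y M U =
     (density U * vel_y U,
      density U * vel_x U * vel_y U,
      density U * (vel_y U)\<^sup>2 + pressure M U,
      vel_y U * (total_energy U + pressure M U))"

definition entropy_flux_x :: "eos \<Rightarrow> state \<Rightarrow> real" where
  "entropy_flux_x M U = density U * vel_x U * entropy M U"

definition entropy_flux_y :: "eos \<Rightarrow> state \<Rightarrow> real" where
  "entropy_flux_y M U = density U * vel_y U * entropy M U"

(* U is a chosen version: periodicity, the values in the phase space and the two relations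
   hold for every angle, not just almost every one. Essential boundedness is implied. *)
definition steady_self_similar_entropy_solution :: "real \<Rightarrow> eos \<Rightarrow> (real \<Rightarrow> state) \<Rightarrow> bool" where
  "steady_self_similar_entropy_solution K M U \<longleftrightarrow>
     (\<forall>\<theta>. U (\<theta> + 2 * pi) = U \<theta>) \<and>
     (\<forall>\<theta>. U \<theta> \<in> phase_space K) \<and>
     U \<in> borel_measurable lebesgue \<and>
     (\<forall>\<theta>\<^sub>1 \<theta>\<^sub>2. \<theta>\<^sub>1 < \<theta>\<^sub>2 \<longrightarrow>
        (sin \<theta>\<^sub>2 *\<^sub>R flux_x M (U \<theta>\<^sub>2) - cos \<theta>\<^sub>2 *\<^sub>R flux_y M (U \<theta>\<^sub>2))
          - (sin \<theta>\<^sub>1 *\<^sub>R flux_x M (U \<theta>\<^sub>1) - cos \<theta>\<^sub>1 *\<^sub>R flux_y M (U \<theta>\<^sub>1))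
        = (LINT \<eta>:{\<theta>\<^sub>1..\<theta>\<^sub>2}|lebesgue. cos \<eta> *\<^sub>R flux_x M (U \<eta>) + sin \<eta> *\<^sub>R flux_y M (U \<eta>))) \<and>
     (\<forall>\<theta>\<^sub>1 \<theta>\<^sub>2. \<theta>\<^sub>1 < \<theta>\<^sub>2 \<longrightarrow>
        (sin \<theta>\<^sub>2 * entropy_flux_x M (U \<theta>\<^sub>2) - cos \<theta>\<^sub>2 * entropy_flux_y M (U \<theta>\<^sub>2))
          - (sin \<theta>\<^sub>1 * entropy_flux_x M (U \<theta>\<^sub>1) - cos \<theta>\<^sub>1 * entropy_flux_y M (U \<theta>\<^sub>1))
        \<le> (LINT \<eta>:{\<theta>\<^sub>1..\<theta>\<^sub>2}|lebesgue.
             cos \<eta> * entropy_flux_x M (U \<eta>) + sin \<eta> * entropy_flux_y M (U \<eta>)))"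

definition normal_velocity :: "(real \<Rightarrow> state) \<Rightarrow> real \<Rightarrow> real" where
  "normal_velocity U \<theta> = vel_x (U \<theta>) * sin \<theta> - vel_y (U \<theta>) * cos \<theta>"

definition forward_shock :: "(real \<Rightarrow> state) \<Rightarrow> real \<Rightarrow> bool" where
  "forward_shock U \<theta>\<^sub>0 \<longleftrightarrow>
     \<not> isCont U \<theta>\<^sub>0 \<and> (\<forall>\<^sub>F \<theta> in nhds \<theta>\<^sub>0. normal_velocity U \<theta> > 0)"

definition backward_shock :: "(real \<Rightarrow> state) \<Rightarrow> real \<Rightarrow> bool" where
  "backward_shock U \<theta>\<^sub>0 \<longleftrightarrow>
     \<not> isCont U \<theta>\<^sub>0 \<and> (\<forall>\<^sub>F \<theta> in nhds \<theta>\<^sub>0. normal_velocity U \<theta> < 0)"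

definition shock :: "(real \<Rightarrow> state) \<Rightarrow> real \<Rightarrow> bool" where
  "shock U \<theta>\<^sub>0 \<longleftrightarrow> forward_shock U \<theta>\<^sub>0 \<or> backward_shock U \<theta>\<^sub>0"

end

theory Submission
  imports Defs
begin

text \<open>
  Let \<open>F\<^sub>\<theta>(V) = sin \<theta> f\<^sup>x(V) - cos \<theta> f\<^sup>y(V)\<close> be the flux through the ray at angle \<open>\<theta>\<close>, \<open>m = \<rho> N\<close> its mass
  component, and \<open>\<Delta> = m\<^sup>2 + p_tau = \<rho>\<^sup>2 (N\<^sup>2 - c\<^sup>2)\<close>. The balance laws say that \<open>F\<^sub>\<theta>(U(\<theta>))\<close> is Lipschitz in
  \<open>\<theta>\<close>. With the entropy inequality and \<open>m \<noteq> 0\<close> they also make \<open>S\<close>, up to the sign of \<open>m\<close>, one-sided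
  Lipschitz, so that \<open>S\<close> has one-sided limits.

  The gas dynamics enters through one fact about pairs of states. If \<open>F\<^sub>\<theta>(V) = F\<^sub>\<theta>(W)\<close> with \<open>m \<noteq> 0\<close>, then
  \<open>V\<close> and \<open>W\<close> lie on a common Hugoniot curve. Followed from its denser state, entropy decreases strictly
  along this curve, and the chord slope \<open>- m\<^sup>2\<close> lies strictly between the values of \<open>p_tau\<close> at the two ends
  (\<open>hugoniot_expansion\<close>). Consequently flux and entropy determine the state, and for \<open>V \<noteq> W\<close> the quantity
  \<open>\<Delta>\<close> is negative at the state with the larger entropy and positive at the other one
  (\<open>equal_fluxes_entropy_order\<close>).

  At every angle with \<open>m \<noteq> 0\<close> this gives one-sided limits of \<open>U\<close>: its values stay in a compact set, and
  both the flux and the entropy converge. At a discontinuity the two limits differ in entropy, and the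
  sign of \<open>m\<close> decides on which side \<open>\<Delta>\<close> is negative and on which it is positive
  (\<open>one_sided_limits\<close>). Near a shock \<open>\<Delta>\<close> therefore has one strict sign on each side. A second
  discontinuity nearby would have values of \<open>\<Delta>\<close> of both signs next to it, so \<open>U\<close> is continuous on both
  sides of the shock.

  Finally, a continuous solution with \<open>m \<Delta> \<noteq> 0\<close> is locally constant (\<open>locally_constant\<close>): with the ray
  kept fixed at angle \<open>t\<close>, the derivative of \<open>F\<^sub>t(U(r))\<close> with respect to \<open>r\<close> vanishes at \<open>r = t\<close>, and the
  linearization of \<open>F\<^sub>t\<close> is injective unless \<open>m \<Delta> = 0\<close> (\<open>primitive_flux_derivative_injective\<close>).
\<close>

section \<open>Calculus\<close>

lemma smooth_on_imp:
  assumes "smooth_on A f"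
  shows smooth_on_imp_differentiable: "x \<in> A \<Longrightarrow> f differentiable (at x)"
    and smooth_on_imp_frechet: "smooth_on A (\<lambda>x. frechet_derivative f (at x) v)"
    and smooth_on_imp_continuous: "continuous_on A f"
proof -
  have "Ck_on (Suc k) A f" for k using assms unfolding smooth_on_def by blast
  then show "x \<in> A \<Longrightarrow> f differentiable (at x)"
    and "smooth_on A (\<lambda>x. frechet_derivative f (at x) v)"
    by (auto simp: smooth_on_def)
  show "continuous_on A f" using assms unfolding smooth_on_def by (metis Ck_on.simps(1))
qed

lemma smooth_on_real_derivative:
  fixes f :: "real \<Rightarrow> real"
  assumes "smooth_on A f" "x \<in> A"
  shows "(f has_real_derivative frechet_derivative f (at x) 1) (at x)"
proof -
  have D: "(f has_derivative frechet_derivative f (at x)) (at x)"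
    using smooth_on_imp_differentiable[OF assms] frechet_derivative_works by blast
  then have "linear (frechet_derivative f (at x))" by (rule has_derivative_linear)
  then have "frechet_derivative f (at x) = (\<lambda>h. frechet_derivative f (at x) 1 * h)"
    by (metis (no_types, opaque_lifting) linear_cmul mult.commute mult.right_neutral real_scaleR_def)
  then show ?thesis using D unfolding has_field_derivative_def by simp
qed

lemma has_derivative_partials:
  fixes f :: "real \<times> real \<Rightarrow> real"
  assumes "f differentiable (at (a, b))"
  defines "A \<equiv> frechet_derivative f (at (a, b)) (1, 0)"
    and "B \<equiv> frechet_derivative f (at (a, b)) (0, 1)"
  shows "(f has_derivative (\<lambda>h. A * fst h + B * snd h)) (at (a, b))"
    and "((\<lambda>t. f (t, b)) has_real_derivative A) (at a)"
    and "((\<lambda>t. f (a, t)) has_real_derivative B) (at b)"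
proof -
  let ?D = "frechet_derivative f (at (a, b))"
  have D: "(f has_derivative ?D) (at (a, b))"
    using assms(1) frechet_derivative_works by blast
  then have lin: "linear ?D" by (rule has_derivative_linear)
  have "?D h = A * fst h + B * snd h" for h
  proof -
    have "h = fst h *\<^sub>R (1, 0) + snd h *\<^sub>R (0, 1)" by (cases h) simp
    then have "?D h = ?D (fst h *\<^sub>R (1, 0) + snd h *\<^sub>R (0, 1))" by simp
    also have "\<dots> = fst h *\<^sub>R A + snd h *\<^sub>R B"
      unfolding A_def B_def linear_add[OF lin] linear_cmul[OF lin] by simp
    finally show ?thesis by simp
  qed
  then have "?D = (\<lambda>h. A * fst h + B * snd h)" by blast
  with D show *: "(f has_derivative (\<lambda>h. A * fst h + B * snd h)) (at (a, b))" by simp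
  have "((\<lambda>t. (t, b)) has_derivative (\<lambda>h. (h, 0))) (at a)"
    by (auto intro!: derivative_eq_intros)
  from has_derivative_compose[OF this *]
  show "((\<lambda>t. f (t, b)) has_real_derivative A) (at a)"
    unfolding has_field_derivative_def by simp
  have "((\<lambda>t. (a, t)) has_derivative (\<lambda>h. (0, h))) (at b)"
    by (auto intro!: derivative_eq_intros)
  from has_derivative_compose[OF this *]
  show "((\<lambda>t. f (a, t)) has_real_derivative B) (at b)"
    unfolding has_field_derivative_def by simp
qed

text \<open>
  A product rule in which the second factor need only be continuous, because the first one vanishes
  at the point. It is needed where no derivative of the second factor is known: the entropy derivative
  along a Hugoniot curve carries such a coefficient, and so do the fluxes of a solution that is merely
  continuous.
\<close>

lemma has_vector_derivative_vanishing_scaleR: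
  fixes D :: "real \<Rightarrow> real" and k :: "real \<Rightarrow> 'a::real_normed_vector"
  assumes "(D has_real_derivative d) (at t)" "D t = 0" "isCont k t"
  shows "((\<lambda>x. D x *\<^sub>R k x) has_vector_derivative d *\<^sub>R k t) (at t)"
proof -
  obtain g where g: "\<And>z. D z - D t = g z * (z - t)" "isCont g t" "g t = d"
    using assms(1) CARAT_DERIV by metis
  have "((\<lambda>z. g z *\<^sub>R k z - d *\<^sub>R k t) \<longlongrightarrow> 0) (at t)"
  proof -
    have "((\<lambda>z. g z *\<^sub>R k z) \<longlongrightarrow> d *\<^sub>R k t) (at t)"
      using g(2,3) assms(3) unfolding isCont_def by (auto intro!: tendsto_intros)
    then show ?thesis by (simp add: LIM_zero)
  qed
  moreover have "(D z *\<^sub>R k z - D t *\<^sub>R k t - (z - t) *\<^sub>R (d *\<^sub>R k t)) /\<^sub>R (z - t)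
      = g z *\<^sub>R k z - d *\<^sub>R k t" if "z \<noteq> t" for z
  proof -
    have "D z *\<^sub>R k z - D t *\<^sub>R k t - (z - t) *\<^sub>R (d *\<^sub>R k t)
        = (z - t) *\<^sub>R (g z *\<^sub>R k z - d *\<^sub>R k t)"
      using g(1)[of z] assms(2) by (simp add: scaleR_diff_right mult.commute)
    then show ?thesis using that by simp
  qed
  ultimately have "((\<lambda>z. (D z *\<^sub>R k z - D t *\<^sub>R k t - (z - t) *\<^sub>R (d *\<^sub>R k t)) /\<^sub>R (z - t)) \<longlongrightarrow> 0) (at t)"
    by (rule_tac Lim_transform_eventually) (auto simp: eventually_at_filter)
  then have "((\<lambda>z. norm (D z *\<^sub>R k z - D t *\<^sub>R k t - (z - t) *\<^sub>R (d *\<^sub>R k t)) / norm (z - t)) \<longlongrightarrow> 0) (at t)"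
    by (drule_tac tendsto_norm_zero) (simp add: divide_inverse mult.commute)
  then show ?thesis
    unfolding has_vector_derivative_def has_derivative_iff_norm
    by (auto simp del: scaleR_scaleR intro: bounded_linear_scaleR_left)
qed

text \<open>
  The derivative of \<open>\<Psi>\<close> at \<open>X t\<close>, being injective and linear, is bounded below, so near \<open>X t\<close> an
  increment of \<open>X\<close> is at most a constant times the increment of \<open>\<Psi> \<circ> X\<close>, which is
  \<open>o(r - t)\<close>. The point is that differentiability of \<open>X\<close> comes out of mere continuity.
\<close>

lemma has_vector_derivative_zero_through_injective_derivative:
  fixes X :: "real \<Rightarrow> 'a::real_normed_vector" and \<Psi> :: "'a \<Rightarrow> 'b::euclidean_space"
  assumes \<Psi>: "(\<Psi> has_derivative A) (at (X t))" and inj: "\<And>h. A h = 0 \<Longrightarrow> h = 0"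
    and X: "isCont X t"
    and zero: "((\<lambda>r. \<Psi> (X r)) has_vector_derivative 0) (at t)"
  shows "(X has_vector_derivative 0) (at t)"
proof -
  have lin: "linear A" using \<Psi> by (rule has_derivative_linear)
  then have "inj A" using inj linear_injective_0 by blast
  with lin obtain B where B: "B > 0" "\<And>x. B * norm x \<le> norm (A x)"
    using linear_inj_bounded_below_pos by blast
  have "\<exists>d>0. \<forall>r. norm (r - t) < d \<longrightarrow> norm (X r - X t) \<le> \<epsilon> * norm (r - t)"
    if \<epsilon>: "\<epsilon> > 0" for \<epsilon>
  proof -
    obtain d1 where d1: "d1 > 0"
      "\<And>y. norm (y - X t) < d1 \<Longrightarrow> norm (\<Psi> y - \<Psi> (X t) - A (y - X t)) \<le> B / 2 * norm (y - X t)"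
      using \<Psi> B(1) unfolding has_derivative_at_alt by (meson half_gt_zero)
    obtain d2 where d2: "d2 > 0" "\<And>r. norm (r - t) < d2 \<Longrightarrow> norm (X r - X t) < d1"
      using X d1(1) unfolding continuous_at_eps_delta by (metis dist_norm)
    obtain d3 where d3: "d3 > 0"
      "\<And>r. norm (r - t) < d3 \<Longrightarrow> norm (\<Psi> (X r) - \<Psi> (X t)) \<le> B / 2 * \<epsilon> * norm (r - t)"
    proof -
      have "B / 2 * \<epsilon> > 0" using B(1) \<epsilon> by simp
      then obtain d where "d > 0"
        "\<And>r. norm (r - t) < d \<Longrightarrow> norm (\<Psi> (X r) - \<Psi> (X t) - (r - t) *\<^sub>R 0) \<le> B / 2 * \<epsilon> * norm (r - t)"
        using zero unfolding has_vector_derivative_def has_derivative_at_alt by meson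
      then show ?thesis using that by simp
    qed
    have "norm (X r - X t) \<le> \<epsilon> * norm (r - t)" if r: "norm (r - t) < min d2 d3" for r
    proof -
      let ?n = "norm (X r - X t)"
      have "B * ?n \<le> norm (A (X r - X t))" by (rule B(2))
      also have "\<dots> \<le> norm (\<Psi> (X r) - \<Psi> (X t)) + norm (\<Psi> (X r) - \<Psi> (X t) - A (X r - X t))"
        using norm_triangle_ineq4[of "\<Psi> (X r) - \<Psi> (X t)" "\<Psi> (X r) - \<Psi> (X t) - A (X r - X t)"]
        by simp
      also have "\<dots> \<le> B / 2 * \<epsilon> * norm (r - t) + B / 2 * ?n"
        using d3(2)[of r] d1(2)[OF d2(2)[of r]] r by (intro add_mono) auto
      finally have "B / 2 * ?n \<le> B / 2 * (\<epsilon> * norm (r - t))" by (simp add: algebra_simps)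
      then show ?thesis using B(1) by simp
    qed
    then show ?thesis using d2(1) d3(1) by (intro exI[of _ "min d2 d3"]) auto
  qed
  then show ?thesis
    unfolding has_vector_derivative_def has_derivative_at_alt by auto
qed

lemma sin_cos_lipschitz:
  fixes s t :: real
  shows "\<bar>sin s - sin t\<bar> \<le> \<bar>s - t\<bar>" "\<bar>cos s - cos t\<bar> \<le> \<bar>s - t\<bar>"
proof -
  have "norm (sin s - sin t) \<le> 1 * norm (s - t)"
    by (rule field_differentiable_bound[of UNIV sin cos]) (auto intro!: derivative_eq_intros)
  then show "\<bar>sin s - sin t\<bar> \<le> \<bar>s - t\<bar>" by simp
  have "norm (cos s - cos t) \<le> 1 * norm (s - t)"
    by (rule field_differentiable_bound[of UNIV cos "\<lambda>x. - sin x"]) (auto intro!: derivative_eq_intros)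
  then show "\<bar>cos s - cos t\<bar> \<le> \<bar>s - t\<bar>" by simp
qed

text \<open>
  Adding a linear function makes \<open>f\<close> monotone, and monotone functions have one-sided limits that
  enclose the value.
\<close>

lemma one_sided_lipschitz_limits:
  fixes f :: "real \<Rightarrow> real"
  assumes x: "a < x" "x < b"
    and lip: "\<And>s t. a < s \<Longrightarrow> s \<le> t \<Longrightarrow> t < b \<Longrightarrow> f t - f s \<le> c * (t - s)"
  obtains l r where "(f \<longlongrightarrow> l) (at_left x)" "(f \<longlongrightarrow> r) (at_right x)" "r \<le> f x" "f x \<le> l"
proof -
  define g where "g t = c * t - f t" for t
  have mono: "g s \<le> g t" if "a < s" "s \<le> t" "t < b" for s t
    using lip[OF that] by (simp add: g_def algebra_simps)
  define L where "L = Sup (g ` ({..<x} \<inter> {a<..<b}))"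
  define R where "R = Inf (g ` ({x<..} \<inter> {a<..<b}))"
  have "(g \<longlongrightarrow> L) (at x within ({..<x} \<inter> {a<..<b}))"
    unfolding L_def by (rule Lim_left_bound[where K = "g x"]) (use x mono in auto)
  moreover have "at x within ({..<x} \<inter> {a<..<b}) = at_left x"
    by (rule at_within_nhd[of _ "{a<..<b}"]) (use x in auto)
  ultimately have gl: "(g \<longlongrightarrow> L) (at_left x)" by simp
  have "(g \<longlongrightarrow> R) (at x within ({x<..} \<inter> {a<..<b}))"
    unfolding R_def by (rule Lim_right_bound[where K = "g x"]) (use x mono in auto)
  moreover have "at x within ({x<..} \<inter> {a<..<b}) = at_right x"
    by (rule at_within_nhd[of _ "{a<..<b}"]) (use x in auto)
  ultimately have gr: "(g \<longlongrightarrow> R) (at_right x)" by simp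
  have "L \<le> g x"
  proof (rule tendsto_upperbound[OF gl])
    show "\<forall>\<^sub>F t in at_left x. g t \<le> g x"
      using eventually_at_left_real[OF x(1)] by eventually_elim (use x mono in auto)
  qed simp
  moreover have "g x \<le> R"
  proof (rule tendsto_lowerbound[OF gr])
    show "\<forall>\<^sub>F t in at_right x. g x \<le> g t"
      using eventually_at_right_real[OF x(2)] by eventually_elim (use x mono in auto)
  qed simp
  moreover have fg: "f = (\<lambda>t. c * t - g t)" by (simp add: g_def)
  have "(f \<longlongrightarrow> c * x - L) (at_left x)" "(f \<longlongrightarrow> c * x - R) (at_right x)"
    by (subst fg, intro tendsto_intros gl gr)+
  ultimately show ?thesis using that[of "c * x - L" "c * x - R"] by (simp add: g_def)
qed

text \<open>
  A continuous injection on a compact set has a continuous inverse on its image, so convergence of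
  \<open>\<Phi> \<circ> f\<close> forces convergence of \<open>f\<close>.
\<close>

lemma compact_injective_tendsto:
  fixes \<Phi> :: "'a::t2_space \<Rightarrow> 'b::t2_space"
  assumes A: "compact A" "continuous_on A \<Phi>" "inj_on \<Phi> A"
    and ev: "\<forall>\<^sub>F x in F. f x \<in> A" and lim: "((\<lambda>x. \<Phi> (f x)) \<longlongrightarrow> y) F" and F: "F \<noteq> bot"
  obtains l where "l \<in> A" "\<Phi> l = y" "(f \<longlongrightarrow> l) F"
proof -
  have "compact (\<Phi> ` A)" using A compact_continuous_image by blast
  then have "y \<in> \<Phi> ` A"
    using Lim_in_closed_set[OF compact_imp_closed _ F lim] ev
    by (smt (verit) eventually_mono imageI)
  then obtain l where l: "l \<in> A" "\<Phi> l = y" by blast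
  have inv: "\<forall>x\<in>A. inv_into A \<Phi> (\<Phi> x) = x" using A(3) by simp
  have "continuous_on (\<Phi> ` A) (inv_into A \<Phi>)"
    using continuous_on_inv[OF A(2,1) inv] .
  then have "((\<lambda>x. inv_into A \<Phi> (\<Phi> (f x))) \<longlongrightarrow> inv_into A \<Phi> y) F"
    by (rule continuous_on_tendsto_compose[OF _ lim])
       (use l ev in \<open>auto elim: eventually_mono\<close>)
  then have "((\<lambda>x. inv_into A \<Phi> (\<Phi> (f x))) \<longlongrightarrow> l) F" using l inv by auto
  then have "(f \<longlongrightarrow> l) F"
    by (rule Lim_transform_eventually) (use ev inv in \<open>auto elim: eventually_mono\<close>)
  with l that show ?thesis by blast
qed

text \<open>
  A function that is not integrable has integral 0 by convention, and then the bound is trivial. So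
  the fluxes of a discontinuous solution can be estimated without discussing their measurability.
\<close>

lemma norm_set_lebesgue_integral_le:
  fixes f :: "real \<Rightarrow> 'a::euclidean_space"
  assumes "a \<le> b" and C: "\<And>x. norm (f x) \<le> C"
  shows "norm (LINT x:{a..b}|lebesgue. f x) \<le> C * (b - a)"
proof (cases "set_integrable lebesgue {a..b} f")
  case True
  have "norm (LINT x:{a..b}|lebesgue. f x) \<le> (LINT x:{a..b}|lebesgue. norm (f x))"
    by (rule set_integral_norm_bound[OF True])
  also have "\<dots> \<le> (LINT x:{a..b}|lebesgue. C)"
  proof (rule set_integral_mono)
    show "set_integrable lebesgue {a..b} (\<lambda>x. norm (f x))" by (rule set_integrable_norm[OF True])
    show "set_integrable lebesgue {a..b} (\<lambda>x. C)"
      by (intro absolutely_integrable_continuous_real) simp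
  qed (rule C)
  also have "\<dots> = C * (b - a)" using assms(1) by (simp add: set_lebesgue_integral_def)
  finally show ?thesis .
next
  case False
  then have "(LINT x:{a..b}|lebesgue. f x) = 0"
    unfolding set_integrable_def set_lebesgue_integral_def by (rule not_integrable_integral_eq)
  moreover have "0 \<le> C" using C norm_ge_zero order_trans by blast
  ultimately show ?thesis using assms(1) by simp
qed

lemma has_vector_derivative_from_integral_increments:
  fixes F G :: "real \<Rightarrow> 'a::euclidean_space"
  assumes incr: "\<And>s t. s < t \<Longrightarrow> F t - F s = (LINT x:{s..t}|lebesgue. G x)"
    and J: "open J" "is_interval J" "t \<in> J" and G: "continuous_on J G"
  shows "(F has_vector_derivative G t) (at t)"
proof -
  obtain e where e: "e > 0" "cball t e \<subseteq> J" using J open_contains_cball by blast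
  define a b where "a = t - e" and "b = t + e"
  have ab: "a < t" "t < b" "{a..b} \<subseteq> J" using e by (auto simp: a_def b_def cball_eq_atLeastAtMost)
  then have G': "continuous_on {a..b} G" using G continuous_on_subset by blast
  have F: "F u = F a + integral {a..u} G" if "u \<in> {a..b}" for u
  proof (cases "a = u")
    case False
    have "(LINT x:{a..u}|lebesgue. G x) = integral {a..u} G"
      using G' that by (intro set_lebesgue_integral_eq_integral absolutely_integrable_continuous_real)
        (auto intro: continuous_on_subset)
    with incr[of a u] that False show ?thesis by (simp add: algebra_simps)
  qed simp
  have "((\<lambda>u. F a + integral {a..u} G) has_vector_derivative G t) (at t within {a..b})"
    using integral_has_vector_derivative[OF G', of t] ab by (auto intro!: derivative_eq_intros)
  from has_vector_derivative_transform[OF _ F this]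
  have "(F has_vector_derivative G t) (at t within {a..b})" using ab by simp
  moreover have "at t within {a..b} = at t"
    using ab by (intro at_within_interior) (simp add: interior_atLeastAtMost_real)
  ultimately show ?thesis by simp
qed


section \<open>Hugoniot curves\<close>

text \<open>
  From here on \<open>z = (\<tau>, s)\<close> is a thermodynamic state, and \<open>p_tau\<close>, \<open>p_s\<close> are the partial derivatives of
  the pressure, so that \<open>p_tau = - \<rho>\<^sup>2 c\<^sup>2\<close> with the sound speed \<open>c\<close>.
\<close>

locale gas =
  fixes K :: real and M :: eos
  assumes K_gt_1: "K > 1" and admissible: "admissible_eos K M"
begin

abbreviation St :: "(real \<times> real) set" where "St \<equiv> eos_states M"
abbreviation pr :: "real \<times> real \<Rightarrow> real" where "pr z \<equiv> eos_pressure M (fst z) (snd z)"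
abbreviation en :: "real \<times> real \<Rightarrow> real" where "en z \<equiv> eos_energy M (fst z) (snd z)"
abbreviation temp :: "real \<times> real \<Rightarrow> real" where "temp z \<equiv> eos_temperature M (fst z) (snd z)"

definition p_tau :: "real \<times> real \<Rightarrow> real" where "p_tau z = frechet_derivative pr (at z) (1, 0)"
definition p_s :: "real \<times> real \<Rightarrow> real" where "p_s z = frechet_derivative pr (at z) (0, 1)"

lemma open_St: "open St"
  and inj_energy: "inj_on (\<lambda>z. (fst z, en z)) St"
  and inj_pressure: "inj_on (\<lambda>z. (fst z, pr z)) St"
  and smooth_pr: "smooth_on St pr"
  and smooth_en: "smooth_on St en"
  and hugoniot_graph: "z \<in> St \<Longrightarrow> \<exists>I G. open I \<and> is_interval I \<and> smooth_on I G \<and>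
        hugoniot_locus M (fst z) (snd z) = {(\<tau>, G \<tau>) | \<tau>. \<tau> \<in> I}"
  using admissible unfolding admissible_eos_def by (auto simp: case_prod_unfold)

lemma state_of_phase_space:
  "V \<in> phase_space K \<Longrightarrow> \<exists>s. (spec_vol V, s) \<in> St \<and> eos_energy M (spec_vol V) s = internal_energy V"
  using admissible unfolding admissible_eos_def by blast

lemma eos_derivatives:
  assumes "z \<in> St"
  shows "deriv (deriv (\<lambda>t. eos_pressure M t (snd z))) (fst z) > 0"
    and "deriv (\<lambda>r. eos_pressure M (fst z) r) (snd z) > 0"
    and "((\<lambda>t. eos_energy M t (snd z)) has_real_derivative - pr z) (at (fst z))"
    and "((\<lambda>r. eos_energy M (fst z) r) has_real_derivative temp z) (at (snd z))"
    and "temp z > 0"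
  using admissible assms unfolding admissible_eos_def by (auto simp: case_prod_unfold)

lemma has_derivative_pr:
  assumes "z \<in> St"
  shows "(pr has_derivative (\<lambda>h. p_tau z * fst h + p_s z * snd h)) (at z)"
  using has_derivative_partials(1)[of pr "fst z" "snd z"] smooth_on_imp_differentiable[OF smooth_pr assms]
  by (simp add: p_tau_def p_s_def)

lemma p_s_pos: assumes "z \<in> St" shows "p_s z > 0"
  using has_derivative_partials(3)[of pr "fst z" "snd z"] smooth_on_imp_differentiable[OF smooth_pr assms]
    eos_derivatives(2)[OF assms] by (simp add: p_s_def DERIV_imp_deriv)

lemma has_derivative_en:
  assumes "z \<in> St"
  shows "(en has_derivative (\<lambda>h. - pr z * fst h + temp z * snd h)) (at z)"
proof -
  have d: "en differentiable (at (fst z, snd z))"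
    using smooth_on_imp_differentiable[OF smooth_en assms] by simp
  have "frechet_derivative en (at z) (1, 0) = - pr z"
    using has_derivative_partials(2)[OF d] eos_derivatives(3)[OF assms] DERIV_unique by fastforce
  moreover have "frechet_derivative en (at z) (0, 1) = temp z"
    using has_derivative_partials(3)[OF d] eos_derivatives(4)[OF assms] DERIV_unique by fastforce
  ultimately show ?thesis using has_derivative_partials(1)[OF d] by simp
qed

lemma continuous_on_thermo:
  shows continuous_on_pr: "continuous_on St pr"
    and continuous_on_en: "continuous_on St en"
    and continuous_on_p_tau: "continuous_on St p_tau"
    and continuous_on_p_s: "continuous_on St p_s"
    and continuous_on_temp: "continuous_on St temp"
proof -
  show "continuous_on St pr" "continuous_on St en"
    using smooth_on_imp_continuous smooth_pr smooth_en by blast+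
  show "continuous_on St p_tau" "continuous_on St p_s"
    unfolding p_tau_def p_s_def
    by (intro smooth_on_imp_continuous[OF smooth_on_imp_frechet[OF smooth_pr]])+
  have "frechet_derivative en (at z) (0, 1) = temp z" if "z \<in> St" for z
    using frechet_derivative_at[OF has_derivative_en[OF that], symmetric] by simp
  then show "continuous_on St temp"
    using smooth_on_imp_continuous[OF smooth_on_imp_frechet[OF smooth_en, of "(0, 1)"]]
    by (simp cong: continuous_on_cong)
qed

text \<open>
  Convexity of the isentropes is given as a condition on the iterated derivative along the line of
  constant entropy; here it becomes the sign of a partial derivative of \<open>p_tau\<close>. The two agree because
  the state set is open, so that nearby points of the line are states as well.
\<close>

lemma p_tau_derivative:
  assumes "z \<in> St"
  obtains A B where "A > 0" "(p_tau has_derivative (\<lambda>h. A * fst h + B * snd h)) (at z)"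
proof -
  have "p_tau differentiable (at (fst z, snd z))"
    using smooth_on_imp_differentiable[OF smooth_on_imp_frechet[OF smooth_pr] assms, of "(1, 0)"]
    by (simp add: p_tau_def[abs_def])
  note P = has_derivative_partials[OF this]
  have ev: "\<forall>\<^sub>F t in nhds (fst z). deriv (\<lambda>t. eos_pressure M t (snd z)) t = p_tau (t, snd z)"
  proof -
    have "\<forall>\<^sub>F t in nhds (fst z). (t, snd z) \<in> St"
    proof (rule eventually_compose_filterlim[of _ "nhds z"])
      show "eventually (\<lambda>x. x \<in> St) (nhds z)"
        using open_St assms eventually_nhds_in_open by blast
      have "((\<lambda>t. (t, snd z)) \<longlongrightarrow> (fst z, snd z)) (nhds (fst z))"
        by (intro tendsto_intros filterlim_ident)
      then show "((\<lambda>t. (t, snd z)) \<longlongrightarrow> z) (nhds (fst z))" by simp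
    qed
    then show ?thesis
    proof eventually_elim
      case (elim t)
      then show ?case
        using has_derivative_partials(2)[of pr t "snd z"]
          smooth_on_imp_differentiable[OF smooth_pr elim] by (simp add: p_tau_def DERIV_imp_deriv)
    qed
  qed
  have "deriv (deriv (\<lambda>t. eos_pressure M t (snd z))) (fst z) = deriv (\<lambda>t. p_tau (t, snd z)) (fst z)"
    by (rule deriv_cong_ev[OF ev]) simp
  also have "\<dots> = frechet_derivative p_tau (at (fst z, snd z)) (1, 0)"
    by (rule DERIV_imp_deriv[OF P(2)])
  finally have "frechet_derivative p_tau (at (fst z, snd z)) (1, 0) > 0"
    using eos_derivatives(1)[OF assms] by simp
  then show ?thesis using P(1) that by simp
qed

text \<open>
  On a Hugoniot curve \<open>p = G(\<tau>)\<close> the entropy is a differentiable function of \<open>\<tau>\<close>. The map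
  \<open>(\<tau>, s) \<mapsto> (\<tau>, p)\<close> is injective, hence by invariance of domain a homeomorphism onto an open set, and
  since \<open>p_s > 0\<close> its inverse is differentiable; the curve is the image of \<open>(\<tau>, G(\<tau>))\<close> under it.
\<close>

lemma hugoniot_parametrization:
  assumes z0: "z\<^sub>0 \<in> St"
  obtains I G s where "open I" "is_interval I" "smooth_on I G"
    "\<And>z. z \<in> St \<Longrightarrow> en z - en z\<^sub>0 + (fst z - fst z\<^sub>0) * (pr z + pr z\<^sub>0) / 2 = 0
        \<Longrightarrow> fst z \<in> I \<and> s (fst z) = snd z"
    "\<And>t. t \<in> I \<Longrightarrow> (t, s t) \<in> St \<and> pr (t, s t) = G t \<and>
        en (t, s t) - en z\<^sub>0 + (t - fst z\<^sub>0) * (G t + pr z\<^sub>0) / 2 = 0 \<and>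
        (s has_real_derivative (frechet_derivative G (at t) 1 - p_tau (t, s t)) / p_s (t, s t)) (at t)"
proof -
  obtain I G where IG: "open I" "is_interval I" "smooth_on I G"
    "hugoniot_locus M (fst z\<^sub>0) (snd z\<^sub>0) = {(\<tau>, G \<tau>) | \<tau>. \<tau> \<in> I}"
    using hugoniot_graph[OF z0] by blast
  let ?f = "\<lambda>z. (fst z, pr z)"
  have contf: "continuous_on St ?f" by (intro continuous_intros continuous_on_pr)
  obtain g where g: "homeomorphism St (?f ` St) ?f g"
    using invariance_of_domain_homeomorphism[OF open_St contf _ inj_pressure] by auto
  have op: "open (?f ` St)" by (rule invariance_of_domain[OF contf open_St inj_pressure])
  define s where "s t = snd (g (t, G t))" for t
  have gf: "g (?f z) = z" if "z \<in> St" for z using g that by (auto simp: homeomorphism_def)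
  have onI: "\<exists>z\<in>St. fst z = t \<and> pr z = G t \<and> en z - en z\<^sub>0 + (t - fst z\<^sub>0) * (G t + pr z\<^sub>0) / 2 = 0"
    if "t \<in> I" for t
  proof -
    have "(t, G t) \<in> hugoniot_locus M (fst z\<^sub>0) (snd z\<^sub>0)" using IG(4) that by blast
    then show ?thesis unfolding hugoniot_locus_def by force
  qed
  have gs: "g (t, G t) = (t, s t)" "(t, G t) \<in> ?f ` St" "(t, s t) \<in> St" "pr (t, s t) = G t"
      "en (t, s t) - en z\<^sub>0 + (t - fst z\<^sub>0) * (G t + pr z\<^sub>0) / 2 = 0"
    if t: "t \<in> I" for t
  proof -
    obtain z where z: "z \<in> St" "fst z = t" "pr z = G t"
      "en z - en z\<^sub>0 + (t - fst z\<^sub>0) * (G t + pr z\<^sub>0) / 2 = 0" using onI[OF t] by blast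
    then have gz: "g (t, G t) = z" using gf[OF z(1)] by simp
    then have "z = (t, s t)" using z(2) by (simp add: s_def prod_eq_iff)
    then show "g (t, G t) = (t, s t)" "(t, s t) \<in> St" "pr (t, s t) = G t"
      "en (t, s t) - en z\<^sub>0 + (t - fst z\<^sub>0) * (G t + pr z\<^sub>0) / 2 = 0" using gz z by auto
    show "(t, G t) \<in> ?f ` St" using z by force
  qed
  have ds: "(s has_real_derivative (frechet_derivative G (at t) 1 - p_tau (t, s t)) / p_s (t, s t)) (at t)"
    if t: "t \<in> I" for t
  proof -
    let ?z = "(t, s t)" and ?G' = "frechet_derivative G (at t) 1"
    let ?Dg = "\<lambda>k. (fst k, (snd k - p_tau ?z * fst k) / p_s ?z)"
    have "p_s ?z > 0" using p_s_pos gs(3)[OF t] by blast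
    have "(g has_derivative ?Dg) (at (t, G t))"
    proof (rule has_derivative_inverse_basic[OF _ _ _ _ op gs(2)[OF t]])
      show "(?f has_derivative (\<lambda>h. (fst h, p_tau ?z * fst h + p_s ?z * snd h))) (at (g (t, G t)))"
        unfolding gs(1)[OF t]
        by (intro has_derivative_Pair has_derivative_pr[OF gs(3)[OF t]] has_derivative_fst has_derivative_ident)
      show "bounded_linear ?Dg"
        by (intro bounded_linear_intros bounded_linear_divide[THEN bounded_linear_compose]
            bounded_linear_Pair)
      show "?Dg \<circ> (\<lambda>h. (fst h, p_tau ?z * fst h + p_s ?z * snd h)) = id"
        using \<open>p_s ?z > 0\<close> by (auto simp: fun_eq_iff)
      show "isCont g (t, G t)"
        using g op gs(2)[OF t] by (auto simp: homeomorphism_def continuous_on_eq_continuous_at)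
      show "?f (g y) = y" if "y \<in> ?f ` St" for y
        using g that unfolding homeomorphism_def by (simp only: )
    qed
    moreover have "((\<lambda>t. (t, G t)) has_derivative (\<lambda>h. (h, ?G' * h))) (at t)"
      using smooth_on_real_derivative[OF IG(3) t]
      by (intro has_derivative_Pair has_derivative_ident) (simp add: has_field_derivative_def)
    ultimately have "((\<lambda>t. g (t, G t)) has_derivative (\<lambda>h. ?Dg (h, ?G' * h))) (at t)"
      by (rule has_derivative_compose[rotated])
    then have "(s has_derivative (\<lambda>h. snd (?Dg (h, ?G' * h)))) (at t)"
      unfolding s_def[abs_def] by (rule has_derivative_snd)
    then show ?thesis unfolding has_field_derivative_def
      by (rule has_derivative_eq_rhs) (simp add: fun_eq_iff algebra_simps)
  qed
  have "fst z \<in> I \<and> s (fst z) = snd z"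
    if z: "z \<in> St" "en z - en z\<^sub>0 + (fst z - fst z\<^sub>0) * (pr z + pr z\<^sub>0) / 2 = 0" for z
  proof -
    have "(fst z, pr z) \<in> hugoniot_locus M (fst z\<^sub>0) (snd z\<^sub>0)"
      using z unfolding hugoniot_locus_def by (cases z) force
    then have "fst z \<in> I" "pr z = G (fst z)" using IG(4) by auto
    then show ?thesis using gf[OF z(1)] by (simp add: s_def)
  qed
  with IG(1-3) gs(3-5) ds that[of I G s] show ?thesis by blast
qed

text \<open>
  Along the Hugoniot curve of \<open>z\<^sub>1\<close>, entropy decreases as long as one moves towards larger specific
  volume. Write \<open>D\<close> for \<open>(\<tau> - \<tau>\<^sub>1)\<^sup>2\<close> times the derivative of the slope \<open>\<sigma>\<close> of the chord from
  \<open>(\<tau>\<^sub>1, p\<^sub>1)\<close>. Differentiating the Hugoniot relation and using \<open>de = T ds - p d\<tau>\<close> gives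
  \<open>D = - 2 T s'\<close>, and hence \<open>G' = p_tau - k D\<close> with \<open>k = p_s / (2 T) > 0\<close>. At a point where \<open>D = 0\<close> also
  \<open>s' = 0\<close>, and one more differentiation yields \<open>G'' (1 + k (\<tau> - \<tau>\<^sub>1)) = p_tau_tau > 0\<close>. As
  \<open>D' = (\<tau> - \<tau>\<^sub>1) G''\<close>, the function \<open>D\<close> starts positive and could cross zero only while increasing,
  so it stays positive.

  Positivity of \<open>1 + k (\<tau> - \<tau>\<^sub>1)\<close> is the reason for starting at the state of smaller volume; any two
  states on a common curve can be ordered that way. The chord slope then exceeds \<open>p_tau\<close> at the dense
  end and is below \<open>p_tau\<close> at the rare end, which are the two Lax inequalities.
\<close>

lemma hugoniot_expansion:
  assumes z: "z\<^sub>1 \<in> St" "z\<^sub>2 \<in> St" and less: "fst z\<^sub>1 < fst z\<^sub>2"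
    and hug: "en z\<^sub>2 - en z\<^sub>1 + (fst z\<^sub>2 - fst z\<^sub>1) * (pr z\<^sub>2 + pr z\<^sub>1) / 2 = 0"
  shows "snd z\<^sub>2 < snd z\<^sub>1"
    and "p_tau z\<^sub>1 < (pr z\<^sub>2 - pr z\<^sub>1) / (fst z\<^sub>2 - fst z\<^sub>1)"
    and "(pr z\<^sub>2 - pr z\<^sub>1) / (fst z\<^sub>2 - fst z\<^sub>1) < p_tau z\<^sub>2"
proof -
  define a b where "a = fst z\<^sub>1" and "b = fst z\<^sub>2"
  have ab: "a < b" using less by (simp add: a_def b_def)
  obtain I G s where I: "open I" "is_interval I" and G: "smooth_on I G"
    and onto: "\<And>z. z \<in> St \<Longrightarrow> en z - en z\<^sub>1 + (fst z - fst z\<^sub>1) * (pr z + pr z\<^sub>1) / 2 = 0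
        \<Longrightarrow> fst z \<in> I \<and> s (fst z) = snd z"
    and curve: "\<And>t. t \<in> I \<Longrightarrow> (t, s t) \<in> St \<and> pr (t, s t) = G t \<and>
        en (t, s t) - en z\<^sub>1 + (t - fst z\<^sub>1) * (G t + pr z\<^sub>1) / 2 = 0 \<and>
        (s has_real_derivative (frechet_derivative G (at t) 1 - p_tau (t, s t)) / p_s (t, s t)) (at t)"
    using hugoniot_parametrization[OF z(1)] by blast
  have ends: "a \<in> I" "(a, s a) = z\<^sub>1" "b \<in> I" "(b, s b) = z\<^sub>2"
    using onto[OF z(1)] onto[OF z(2) hug] by (auto simp: a_def b_def prod_eq_iff)
  have Ga: "G a = pr z\<^sub>1" and Gb: "G b = pr z\<^sub>2" using curve ends by metis+
  have abI: "t \<in> I" if "a \<le> t" "t \<le> b" for t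
    using I(2) ends that unfolding is_interval_1 by blast
  define G' where "G' t = frechet_derivative G (at t) 1" for t
  define G'' where "G'' t = frechet_derivative G' (at t) 1" for t
  have smG': "smooth_on I G'" unfolding G'_def[abs_def] by (rule smooth_on_imp_frechet[OF G])
  have dG: "(G has_real_derivative G' t) (at t)" if "t \<in> I" for t
    unfolding G'_def by (rule smooth_on_real_derivative[OF G that])
  have dG': "(G' has_real_derivative G'' t) (at t)" if "t \<in> I" for t
    unfolding G''_def by (rule smooth_on_real_derivative[OF smG' that])
  have contG'': "continuous_on I G''"
    unfolding G''_def by (rule smooth_on_imp_continuous[OF smooth_on_imp_frechet[OF smG']])
  define c where "c t = (t, s t)" for t
  define s' where "s' t = (G' t - p_tau (c t)) / p_s (c t)" for t
  have c: "c t \<in> St" "pr (c t) = G t" "(s has_real_derivative s' t) (at t)"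
    "p_s (c t) > 0" "temp (c t) > 0" if "t \<in> I" for t
    using curve[OF that] p_s_pos eos_derivatives(5) by (auto simp: c_def s'_def G'_def)
  have dc: "(c has_derivative (\<lambda>h. (h, s' t * h))) (at t)" if "t \<in> I" for t
    using c(3)[OF that] unfolding c_def
    by (intro has_derivative_Pair has_derivative_ident) (simp add: has_field_derivative_def)
  define D where "D t = (t - a) * G' t - (G t - pr z\<^sub>1)" for t
  \<comment> \<open>The derivative of the Hugoniot relation, simplified by \<open>de = T ds - p d\<tau>\<close>.\<close>
  have Ds: "D t = - 2 * temp (c t) * s' t" if t: "t \<in> I" for t
  proof -
    let ?h = "\<lambda>t. en (c t) - en z\<^sub>1 + (t - a) * (G t + pr z\<^sub>1) / 2"
    have "((\<lambda>t. en (c t)) has_real_derivative (- G t + temp (c t) * s' t)) (at t)"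
      using has_derivative_compose[OF dc[OF t] has_derivative_en[OF c(1)[OF t]]] c(2)[OF t]
      unfolding has_field_derivative_def
      by (rule_tac has_derivative_eq_rhs) (auto simp: fun_eq_iff algebra_simps)
    then have "(?h has_real_derivative
        (- G t + temp (c t) * s' t + ((G t + pr z\<^sub>1) + (t - a) * G' t) / 2)) (at t)"
      by (auto intro!: derivative_eq_intros dG[OF t])
    moreover have "(?h has_real_derivative 0) (at t)"
    proof (rule has_field_derivative_transform_within_open[OF DERIV_const I(1) t])
      show "0 = ?h x" if "x \<in> I" for x using curve[OF that] by (simp add: c_def a_def)
    qed
    ultimately have "- G t + temp (c t) * s' t + ((G t + pr z\<^sub>1) + (t - a) * G' t) / 2 = 0"
      by (rule DERIV_unique)
    then show ?thesis by (simp add: D_def field_simps)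
  qed
  define k where "k t = p_s (c t) / (2 * temp (c t))" for t
  have kpos: "k t > 0" if "t \<in> I" for t using c(4,5)[OF that] by (simp add: k_def)
  \<comment> \<open>Solve \<open>D = - 2 T s'\<close> and \<open>G' = p_tau + p_s s'\<close> for \<open>G'\<close>.\<close>
  have G'D: "G' t = p_tau (c t) - k t * D t" if "t \<in> I" for t
    using c(4,5)[OF that] Ds[OF that] by (simp add: k_def s'_def field_simps)
  have dD: "(D has_real_derivative (t - a) * G'' t) (at t)" if "t \<in> I" for t
    unfolding D_def by (auto intro!: derivative_eq_intros dG[OF that] dG'[OF that])
  have contk: "isCont k t" if t: "t \<in> I" for t
  proof -
    have cc: "isCont c t" using dc[OF t] has_derivative_continuous by blast
    have "isCont (\<lambda>t. p_s (c t)) t" "isCont (\<lambda>t. temp (c t)) t"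
      using isCont_o2[OF cc] continuous_on_p_s continuous_on_temp c(1)[OF t] open_St
      by (auto simp: continuous_on_eq_continuous_at)
    then show ?thesis unfolding k_def using c(5)[OF t] by (intro continuous_intros) auto
  qed
  \<comment> \<open>The convexity step: at a zero of \<open>D\<close> the second derivative of \<open>G\<close> inherits the sign of the second
    volume derivative of the pressure.\<close>
  have G''pos: "G'' t > 0" if t: "t \<in> I" "a \<le> t" and D0: "D t = 0" for t
  proof -
    obtain A B where A: "A > 0" "(p_tau has_derivative (\<lambda>h. A * fst h + B * snd h)) (at (c t))"
      using p_tau_derivative[OF c(1)[OF t(1)]] by blast
    have "s' t = 0" using Ds[OF t(1)] D0 c(5)[OF t(1)] by simp
    then have dp: "((\<lambda>t. p_tau (c t)) has_real_derivative A) (at t)"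
      using has_derivative_compose[OF dc[OF t(1)] A(2)] by (simp add: has_field_derivative_def)
    have "((\<lambda>t. D t *\<^sub>R k t) has_vector_derivative ((t - a) * G'' t) *\<^sub>R k t) (at t)"
      by (rule has_vector_derivative_vanishing_scaleR[OF dD[OF t(1)] D0 contk[OF t(1)]])
    then have "((\<lambda>t. k t * D t) has_real_derivative ((t - a) * G'' t) * k t) (at t)"
      by (simp add: has_real_derivative_iff_has_vector_derivative mult.commute)
    from DERIV_diff[OF dp this]
    have "(G' has_real_derivative A - ((t - a) * G'' t) * k t) (at t)"
      by (rule has_field_derivative_transform_within_open[OF _ I(1) t(1)]) (simp add: G'D)
    then have "G'' t = A - ((t - a) * G'' t) * k t" using dG'[OF t(1)] DERIV_unique by blast
    then have "G'' t * (1 + (t - a) * k t) = A" by (simp add: algebra_simps)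
    moreover have "1 + (t - a) * k t > 0" using t kpos[OF t(1)] by (simp add: add_pos_nonneg)
    ultimately show ?thesis using A(1) by (metis zero_less_mult_pos2)
  qed
  have Da: "D a = 0" by (simp add: D_def Ga)
  then have G'a: "G' a = p_tau z\<^sub>1" using G'D[OF ends(1)] ends(2) by (simp add: c_def)
  obtain d where d: "a < d" "d \<le> b" "\<And>t. a \<le> t \<Longrightarrow> t \<le> d \<Longrightarrow> G'' t > 0"
  proof -
    have "G'' a > 0" using G''pos[OF ends(1) _ Da] by simp
    moreover have "isCont G'' a"
      using contG'' I(1) ends(1) by (auto simp: continuous_on_eq_continuous_at)
    ultimately have "\<forall>\<^sub>F t in nhds a. G'' t > 0"
      by (metis eventually_nhds_conv_at order_tendsto_iff isCont_def)
    then obtain e where "e > 0" "\<And>t. dist t a < e \<Longrightarrow> G'' t > 0"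
      unfolding eventually_nhds_metric by blast
    then show ?thesis using that[of "min b (a + e / 2)"] ab by (auto simp: dist_real_def)
  qed
  have contD: "continuous_on {x..y} D" if "a \<le> x" "y \<le> b" for x y
  proof (rule DERIV_atLeastAtMost_imp_continuous_on)
    show "\<exists>l. (D has_real_derivative l) (at t)" if "x \<le> t" "t \<le> y" for t
      using dD[OF abI[of t]] that \<open>a \<le> x\<close> \<open>y \<le> b\<close> by force
  qed
  have Dnear: "D t > 0" if "a < t" "t \<le> d" for t
  proof -
    have "D a < D t"
    proof (rule DERIV_pos_imp_increasing_open[OF that(1)])
      show "\<exists>y. (D has_real_derivative y) (at x) \<and> y > 0" if "a < x" "x < t" for x
        using dD[OF abI[of x]] d(2) d(3)[of x] that \<open>t \<le> d\<close> by (intro exI[of _ "(x - a) * G'' x"]) auto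
      show "continuous_on {a..t} D" using contD that d(2) by simp
    qed
    then show ?thesis using Da by simp
  qed
  have Dpos: "D t > 0" if "a < t" "t \<le> b" for t
  proof (rule ccontr)
    assume neg: "\<not> D t > 0"
    let ?Z = "{x \<in> {d..b}. D x \<le> 0}"
    have td: "t \<in> ?Z" using neg Dnear[of t] that by force
    have clo: "closed ?Z"
      using continuous_on_closed_Collect_le[OF contD[of d b] continuous_on_const] d by simp
    have bdd: "bdd_below ?Z" by (rule bdd_belowI[of _ d]) auto
    \<comment> \<open>The first zero of \<open>D\<close> after the initial stretch; there \<open>D\<close> would have to increase, although it is
      positive before.\<close>
    define m where "m = Inf ?Z"
    have mZ: "m \<in> ?Z" unfolding m_def
      using closed_contains_Inf[OF _ bdd clo] td by blast
    have before: "D x > 0" if "a < x" "x < m" for x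
    proof (cases "x \<le> d")
      case False
      then have "x \<notin> ?Z" using cInf_lower[OF _ bdd, of x] that by (auto simp: m_def)
      with False that mZ show ?thesis by auto
    qed (use Dnear that in auto)
    have m: "d < m" "m \<le> b" using mZ Dnear[of d] d(1) by (auto simp: less_le)
    have "D m \<ge> 0"
    proof (rule tendsto_lowerbound)
      show "(D \<longlongrightarrow> D m) (at_left m)"
        using dD[OF abI[of m]] m d(1) DERIV_isCont[of D] by (auto simp: isCont_def filterlim_at_split)
      have "a < m" using m d by simp
      from eventually_at_left_real[OF this]
      show "\<forall>\<^sub>F x in at_left m. 0 \<le> D x" by eventually_elim (use before in force)
    qed simp
    then have "D m = 0" using mZ by auto
    moreover have "m \<in> I" using abI m d by simp
    ultimately have "(m - a) * G'' m > 0" using G''pos[of m] m d by simp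
    then obtain e where e: "e > 0" "\<And>h. h > 0 \<Longrightarrow> h < e \<Longrightarrow> D (m - h) < D m"
      using DERIV_pos_inc_left[OF dD[OF \<open>m \<in> I\<close>]] by blast
    define h where "h = min (e / 2) ((m - a) / 2)"
    have "h > 0" "h < e" "a < m - h"
      using e(1) m(1) d(1) by (auto simp: h_def min_def field_simps)
    then show False using e(2)[of h] before[of "m - h"] \<open>D m = 0\<close> by auto
  qed
  have s'neg: "s' t < 0" if "a < t" "t \<le> b" for t
    using Dpos[OF that] Ds[OF abI[of t]] c(5)[OF abI[of t]] that
    by (simp add: mult_less_0_iff zero_less_mult_iff)
  have "s b < s a"
  proof (rule DERIV_neg_imp_decreasing_open[OF ab])
    show "\<exists>y. (s has_real_derivative y) (at x) \<and> y < 0" if "a < x" "x < b" for x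
      using c(3)[OF abI] s'neg that by (meson less_imp_le)
    show "continuous_on {a..b} s"
      using c(3)[OF abI] by (intro DERIV_atLeastAtMost_imp_continuous_on) blast
  qed
  then show "snd z\<^sub>2 < snd z\<^sub>1" using ends by (metis snd_conv)
  define \<sigma> where "\<sigma> t = (G t - G a) / (t - a)" for t
  have d\<sigma>: "(\<sigma> has_real_derivative D t / (t - a)\<^sup>2) (at t)" if "a < t" "t \<le> b" for t
    unfolding \<sigma>_def using that dG[OF abI[of t]]
    by (auto intro!: derivative_eq_intros simp: D_def Ga power2_eq_square field_simps)
  have "G' a < \<sigma> d"
  proof -
    have "\<exists>x>a. x < d \<and> G d - G a = (d - a) * G' x"
      by (rule MVT2[OF d(1)]) (use dG abI d in auto)
    then obtain x where x: "a < x" "x < d" "G d - G a = (d - a) * G' x" by blast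
    have "G' a < G' x"
    proof (rule DERIV_pos_imp_increasing[OF x(1)])
      show "\<exists>r. (G' has_real_derivative r) (at y) \<and> 0 < r" if "a \<le> y" "y \<le> x" for y
        using dG'[OF abI[of y]] d(2) d(3)[of y] that x(2) by (intro exI[of _ "G'' y"]) auto
    qed
    then show ?thesis using x d(1) by (simp add: \<sigma>_def)
  qed
  also have "\<sigma> d \<le> \<sigma> b"
  proof (rule DERIV_nonneg_imp_nondecreasing[OF d(2)])
    show "\<exists>y. (\<sigma> has_real_derivative y) (at x) \<and> 0 \<le> y" if "d \<le> x" "x \<le> b" for x
      using d\<sigma>[of x] Dpos[of x] that d(1) by (intro exI[of _ "D x / (x - a)\<^sup>2"]) auto
  qed
  finally have "G' a < \<sigma> b" .
  moreover have \<sigma>b: "\<sigma> b = (pr z\<^sub>2 - pr z\<^sub>1) / (fst z\<^sub>2 - fst z\<^sub>1)"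
    unfolding \<sigma>_def Ga Gb by (simp add: a_def b_def)
  ultimately show "p_tau z\<^sub>1 < (pr z\<^sub>2 - pr z\<^sub>1) / (fst z\<^sub>2 - fst z\<^sub>1)" using G'a by simp
  have "\<sigma> b < G' b" using Dpos[of b] ab by (simp add: \<sigma>_def D_def Ga field_simps)
  also have "\<dots> < p_tau z\<^sub>2"
    using G'D[OF ends(3)] kpos[OF ends(3)] Dpos[of b] ab ends(4) by (simp add: c_def)
  finally show "(pr z\<^sub>2 - pr z\<^sub>1) / (fst z\<^sub>2 - fst z\<^sub>1) < p_tau z\<^sub>2" by (simp add: \<sigma>b)
qed

end

section \<open>States and fluxes\<close>

lemma density_pos:
  assumes "K > 1" "V \<in> phase_space K" shows "density V > 0"
proof -
  have "1 / K \<le> density V" "1 / K > 0" using assms by (auto simp: phase_space_def)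
  then show ?thesis by linarith
qed

lemma continuous_on_components:
  assumes "\<And>V. V \<in> A \<Longrightarrow> density V \<noteq> 0"
  shows "continuous_on A density" "continuous_on A vel_x" "continuous_on A vel_y"
    "continuous_on A total_energy" "continuous_on A spec_vol" "continuous_on A internal_energy"
proof -
  show 1: "continuous_on A density" "continuous_on A total_energy"
    unfolding density_def[abs_def] total_energy_def[abs_def] by (intro continuous_intros)+
  show 2: "continuous_on A vel_x" "continuous_on A vel_y" "continuous_on A spec_vol"
    unfolding vel_x_def[abs_def] vel_y_def[abs_def] spec_vol_def[abs_def]
    by (intro continuous_intros 1; use assms in simp)+
  show "continuous_on A internal_energy"
    unfolding internal_energy_def[abs_def] by (intro continuous_intros 1 2; use assms in simp)
qed

lemma compact_phase_space:
  assumes "K > 1" shows "compact (phase_space K)"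
proof -
  let ?B = "{V. 1 / K \<le> density V \<and> density V \<le> K \<and> norm V \<le> K} :: state set"
  have "closed ?B"
    unfolding density_def by (intro closed_Collect_conj closed_Collect_le continuous_intros)
  moreover have "bounded ?B" by (rule boundedI[of _ K]) auto
  ultimately have B: "compact ?B" using compact_eq_bounded_closed by blast
  have pos: "density V \<noteq> 0" if "V \<in> ?B" for V
  proof -
    have "1 / K > 0" using assms by simp
    then show ?thesis using that by auto
  qed
  have "closed (?B \<inter> internal_energy -` {1 / K..K})"
    by (rule continuous_closed_preimage[OF continuous_on_components(6)[OF pos] \<open>closed ?B\<close>]) auto
  then have "compact (?B \<inter> (?B \<inter> internal_energy -` {1 / K..K}))"
    using B compact_Int_closed by blast
  moreover have "?B \<inter> (?B \<inter> internal_energy -` {1 / K..K}) = phase_space K"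
    unfolding phase_space_def by auto
  ultimately show ?thesis by simp
qed

text \<open>
  The flux through the ray at angle \<open>\<theta>\<close>, with normal \<open>(sin \<theta>, - cos \<theta>)\<close>.
\<close>

definition angular_flux :: "eos \<Rightarrow> real \<Rightarrow> state \<Rightarrow> state" where
  "angular_flux M \<theta> V = sin \<theta> *\<^sub>R flux_x M V - cos \<theta> *\<^sub>R flux_y M V"

lemma fst_angular_flux:
  "fst (angular_flux M \<theta> V) = density V * (vel_x V * sin \<theta> - vel_y V * cos \<theta>)"
  by (simp add: angular_flux_def flux_x_def flux_y_def algebra_simps)

definition thermo_state :: "eos \<Rightarrow> state \<Rightarrow> real \<times> real" where
  "thermo_state M V = (spec_vol V, entropy M V)"

text \<open>
  The thermodynamic part comes first because all hypotheses on the gas speak of \<open>(\<tau>, s)\<close>. In these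
  variables the fluxes involve only pressure and energy as functions on the state set, whereas in
  conserved variables one would have to differentiate the entropy.
\<close>

definition primitive :: "eos \<Rightarrow> state \<Rightarrow> (real \<times> real) \<times> real \<times> real" where
  "primitive M V = (thermo_state M V, vel_x V, vel_y V)"

context gas begin

definition mass_flux :: "real \<Rightarrow> (real \<times> real) \<times> real \<times> real \<Rightarrow> real" where
  "mass_flux \<theta> = (\<lambda>(z, u, v). (u * sin \<theta> - v * cos \<theta>) / fst z)"

definition primitive_flux :: "real \<Rightarrow> (real \<times> real) \<times> real \<times> real \<Rightarrow> state" where
  "primitive_flux \<theta> = (\<lambda>(z, u, v).
     let m = mass_flux \<theta> (z, u, v) in
     (m, m * u + pr z * sin \<theta>, m * v - pr z * cos \<theta>,
      m * ((u\<^sup>2 + v\<^sup>2) / 2 + en z + pr z * fst z)))"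

abbreviation PS :: "state set" where "PS \<equiv> phase_space K"

lemma thermo_state_in_St:
  assumes "V \<in> PS"
  shows "thermo_state M V \<in> St" "en (thermo_state M V) = internal_energy V"
proof -
  have "\<exists>!s. (spec_vol V, s) \<in> St \<and> eos_energy M (spec_vol V) s = internal_energy V"
    using state_of_phase_space[OF assms] inj_energy unfolding inj_on_def by (metis fst_conv prod.inject snd_conv)
  from theI'[OF this]
  show "thermo_state M V \<in> St" "en (thermo_state M V) = internal_energy V"
    by (auto simp: thermo_state_def entropy_def)
qed

lemma spec_vol_pos: assumes "V \<in> PS" shows "spec_vol V > 0"
  using density_pos[OF K_gt_1 assms] by (simp add: spec_vol_def)

lemma PS_density: "V \<in> PS \<Longrightarrow> density V \<noteq> 0"
  using density_pos[OF K_gt_1] by (metis less_irrefl)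

text \<open>
  The map \<open>(\<tau>, s) \<mapsto> (\<tau>, e)\<close> is an injective continuous map of an open planar set, so by invariance of
  domain its inverse is continuous, and the entropy depends continuously on volume and energy.
\<close>

lemma continuous_on_thermo_state: "continuous_on PS (thermo_state M)"
proof -
  let ?f = "\<lambda>z. (fst z, en z)"
  have "continuous_on St ?f" by (intro continuous_intros continuous_on_en)
  then obtain g where g: "homeomorphism St (?f ` St) ?f g"
    using invariance_of_domain_homeomorphism[OF open_St _ _ inj_energy] by auto
  have eq: "?f (thermo_state M V) = (spec_vol V, internal_energy V)" if "V \<in> PS" for V
    using thermo_state_in_St(2)[OF that] by (simp add: thermo_state_def)
  have "continuous_on PS (\<lambda>V. g (spec_vol V, internal_energy V))"
  proof (rule continuous_on_compose2[of "?f ` St" g])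
    show "continuous_on (?f ` St) g" using g by (simp add: homeomorphism_def)
    show "continuous_on PS (\<lambda>V. (spec_vol V, internal_energy V))"
      by (intro continuous_intros continuous_on_components PS_density)
    show "(\<lambda>V. (spec_vol V, internal_energy V)) ` PS \<subseteq> ?f ` St"
      using eq thermo_state_in_St(1) by (auto simp: image_iff) metis
  qed
  moreover have "g (spec_vol V, internal_energy V) = thermo_state M V" if "V \<in> PS" for V
    using g thermo_state_in_St(1)[OF that] eq[OF that] unfolding homeomorphism_def by metis
  ultimately show ?thesis by (simp cong: continuous_on_cong)
qed

lemma continuous_on_entropy: "continuous_on PS (entropy M)"
  using continuous_on_snd[OF continuous_on_thermo_state] by (simp add: thermo_state_def)

lemma continuous_on_pressure: "continuous_on PS (pressure M)"
proof -
  have "continuous_on PS (\<lambda>V. pr (thermo_state M V))"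
    by (rule continuous_on_compose2[OF continuous_on_pr continuous_on_thermo_state])
       (use thermo_state_in_St in auto)
  then show ?thesis by (simp add: thermo_state_def pressure_def[abs_def])
qed

lemma continuous_on_fluxes:
  "continuous_on PS (flux_x M)" "continuous_on PS (flux_y M)"
  "continuous_on PS (entropy_flux_x M)" "continuous_on PS (entropy_flux_y M)"
  unfolding flux_x_def[abs_def] flux_y_def[abs_def] entropy_flux_x_def[abs_def] entropy_flux_y_def[abs_def]
  by (intro continuous_intros continuous_on_components PS_density continuous_on_pressure
      continuous_on_entropy; assumption)+

lemma continuous_on_angular_flux: "continuous_on PS (angular_flux M \<theta>)"
  unfolding angular_flux_def by (intro continuous_intros continuous_on_fluxes)

lemma continuous_on_primitive: "continuous_on PS (primitive M)"
  unfolding primitive_def by (intro continuous_intros continuous_on_thermo_state continuous_on_components PS_density)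

lemma inj_primitive: "inj_on (primitive M) PS"
proof (rule inj_onI)
  fix V W assume VW: "V \<in> PS" "W \<in> PS" "primitive M V = primitive M W"
  then have eq: "spec_vol V = spec_vol W" "vel_x V = vel_x W" "vel_y V = vel_y W"
    "thermo_state M V = thermo_state M W"
    by (auto simp: primitive_def thermo_state_def)
  have d: "density V = density W" using eq(1) by (simp add: spec_vol_def)
  have e: "internal_energy V = internal_energy W"
    using thermo_state_in_St(2)[OF VW(1)] thermo_state_in_St(2)[OF VW(2)] eq(4) by simp
  have "total_energy V / density W = total_energy W / density W"
    using e eq(2,3) d by (simp add: internal_energy_def)
  then have "total_energy V = total_energy W" using PS_density[OF VW(2)] by simp
  moreover have "fst (snd V) = fst (snd W)" "fst (snd (snd V)) = fst (snd (snd W))"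
    using eq(2,3) d PS_density[OF VW(2)] by (auto simp: vel_x_def vel_y_def)
  ultimately show "V = W" using d by (simp add: prod_eq_iff density_def total_energy_def)
qed

lemma angular_flux_primitive:
  assumes "V \<in> PS" shows "angular_flux M \<theta> V = primitive_flux \<theta> (primitive M V)"
proof -
  have d: "density V \<noteq> 0" using PS_density[OF assms] .
  have E: "total_energy V = density V * ((vel_x V)\<^sup>2 / 2 + (vel_y V)\<^sup>2 / 2 + en (thermo_state M V))"
    using d unfolding thermo_state_in_St(2)[OF assms] by (simp add: internal_energy_def field_simps)
  have p: "pressure M V = pr (thermo_state M V)" by (simp add: pressure_def thermo_state_def)
  have t: "fst (thermo_state M V) = 1 / density V" by (simp add: thermo_state_def spec_vol_def)
  show ?thesis
    unfolding angular_flux_def flux_x_def flux_y_def primitive_flux_def primitive_def E p mass_flux_def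
    using d by (simp add: t Let_def power2_eq_square field_simps)
qed

lemma mass_flux_primitive: "mass_flux \<theta> (primitive M V) = fst (angular_flux M \<theta> V)"
  unfolding fst_angular_flux by (simp add: mass_flux_def primitive_def thermo_state_def spec_vol_def mult.commute)

section \<open>Jump conditions and characteristics\<close>

text \<open>
  Since \<open>p_tau = - \<rho>\<^sup>2 c\<^sup>2\<close>, this is \<open>\<rho>\<^sup>2 (N\<^sup>2 - c\<^sup>2)\<close>: it is positive where the normal velocity is supersonic,
  negative where it is subsonic, and zero where the ray is a Mach line.
\<close>

definition char_disc :: "real \<Rightarrow> (real \<times> real) \<times> real \<times> real \<Rightarrow> real" where
  "char_disc \<theta> Z = (mass_flux \<theta> Z)\<^sup>2 + p_tau (fst Z)"

text \<open>
  The classical elimination of velocity. With \<open>N = m \<tau>\<close> on both sides, the momentum balance makes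
  the velocity jump normal to the ray with size \<open>- [p] / m\<close>; this gives the slope \<open>- m\<^sup>2\<close> of the chord in
  the \<open>(\<tau>, p)\<close> plane and the jump \<open>- [p] (\<tau> + \<tau>')\<close> of the squared speed. Put into the energy balance, the
  latter leaves the Hugoniot relation.
\<close>

lemma rankine_hugoniot:
  assumes eq: "primitive_flux \<theta> (z, u, v) = primitive_flux \<theta> (z', u', v')"
    and pos: "fst z > 0" "fst z' > 0" and m: "mass_flux \<theta> (z, u, v) \<noteq> 0"
  shows "pr z' - pr z = - (mass_flux \<theta> (z, u, v))\<^sup>2 * (fst z' - fst z)" (is ?P)
    and "en z' - en z + (fst z' - fst z) * (pr z' + pr z) / 2 = 0" (is ?E)
    and "fst z = fst z' \<Longrightarrow> u = u' \<and> v = v'"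
proof -
  define m where "m = mass_flux \<theta> (z, u, v)"
  have m': "mass_flux \<theta> (z', u', v') = m" and "m \<noteq> 0"
    using eq assms(4) by (auto simp: primitive_flux_def m_def Let_def)
  have N: "u * sin \<theta> - v * cos \<theta> = m * fst z" "u' * sin \<theta> - v' * cos \<theta> = m * fst z'"
  proof -
    show "u * sin \<theta> - v * cos \<theta> = m * fst z" using pos by (simp add: m_def mass_flux_def)
    show "u' * sin \<theta> - v' * cos \<theta> = m * fst z'"
      using pos unfolding m'[symmetric] by (simp add: mass_flux_def)
  qed
  have c: "m * (u' - u) = - (pr z' - pr z) * sin \<theta>" "m * (v' - v) = (pr z' - pr z) * cos \<theta>"
    "m * ((u\<^sup>2 + v\<^sup>2) / 2 + en z + pr z * fst z) = m * ((u'\<^sup>2 + v'\<^sup>2) / 2 + en z' + pr z' * fst z')"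
    using eq unfolding primitive_flux_def m'[symmetric] by (auto simp: Let_def m' m_def[symmetric] algebra_simps)
  have sc: "sin \<theta> * sin \<theta> + cos \<theta> * cos \<theta> = 1" using sin_cos_squared_add[of \<theta>] by (simp only: power2_eq_square)
  have "m * (m * (fst z' - fst z)) = (m * (u' - u)) * sin \<theta> - (m * (v' - v)) * cos \<theta>"
    using N by (simp add: algebra_simps)
  also have "\<dots> = - (pr z' - pr z) * (sin \<theta> * sin \<theta> + cos \<theta> * cos \<theta>)"
    unfolding c by algebra
  also have "\<dots> = - (pr z' - pr z)" unfolding sc by simp
  finally show P: ?P unfolding m_def[symmetric] by (simp add: power2_eq_square algebra_simps)
  have "m * ((u'\<^sup>2 + v'\<^sup>2) - (u\<^sup>2 + v\<^sup>2)) = (m * (u' - u)) * (u' + u) + (m * (v' - v)) * (v' + v)"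
    by (simp add: power2_eq_square algebra_simps)
  also have "\<dots> = - (pr z' - pr z) * ((u' * sin \<theta> - v' * cos \<theta>) + (u * sin \<theta> - v * cos \<theta>))"
    unfolding c by (simp add: algebra_simps)
  also have "\<dots> = m * (- (pr z' - pr z) * (fst z' + fst z))" unfolding N by (simp add: algebra_simps)
  finally have K: "(u'\<^sup>2 + v'\<^sup>2) - (u\<^sup>2 + v\<^sup>2) = - (pr z' - pr z) * (fst z' + fst z)"
    using \<open>m \<noteq> 0\<close> by simp
  have "(u\<^sup>2 + v\<^sup>2) / 2 + en z + pr z * fst z = (u'\<^sup>2 + v'\<^sup>2) / 2 + en z' + pr z' * fst z'"
    using c(3) \<open>m \<noteq> 0\<close> by simp
  then have "en z' - en z = - (pr z' * fst z' - pr z * fst z) - ((u'\<^sup>2 + v'\<^sup>2) - (u\<^sup>2 + v\<^sup>2)) / 2"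
    by (simp add: field_simps)
  then show ?E unfolding K by (simp add: field_simps)
  show "u = u' \<and> v = v'" if "fst z = fst z'"
    using c(1,2) P that \<open>m \<noteq> 0\<close> by simp
qed

text \<open>
  Two different states with the same flux through a ray and \<open>m \<noteq> 0\<close> lie on a common Hugoniot curve, with chord
  slope \<open>- m\<^sup>2\<close>. The denser one has the larger entropy and is subsonic, the rarer one is supersonic.
  In particular flux and entropy together determine the state.
\<close>

lemma equal_fluxes_entropy_order:
  assumes VW: "V \<in> PS" "W \<in> PS" and eq: "angular_flux M \<theta> V = angular_flux M \<theta> W"
    and m: "fst (angular_flux M \<theta> V) \<noteq> 0"
  shows "entropy M V = entropy M W \<Longrightarrow> V = W"
    and "entropy M W < entropy M V \<Longrightarrow>
      char_disc \<theta> (primitive M V) < 0 \<and> 0 < char_disc \<theta> (primitive M W)"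
proof -
  have expansion: "entropy M W < entropy M V \<and>
      char_disc \<theta> (primitive M V) < 0 \<and> 0 < char_disc \<theta> (primitive M W)"
    if VW: "V \<in> PS" "W \<in> PS" and eq: "angular_flux M \<theta> V = angular_flux M \<theta> W"
    and m: "fst (angular_flux M \<theta> V) \<noteq> 0" and less: "spec_vol V < spec_vol W" for V W
  proof -
    let ?z = "thermo_state M V" and ?z' = "thermo_state M W"
    have z: "?z \<in> St" "?z' \<in> St" and fz: "fst ?z = spec_vol V" "fst ?z' = spec_vol W"
      using thermo_state_in_St VW by (auto simp: thermo_state_def)
    have eq': "primitive_flux \<theta> (?z, vel_x V, vel_y V) = primitive_flux \<theta> (?z', vel_x W, vel_y W)"
      using eq by (simp add: angular_flux_primitive VW primitive_def)
    define m where "m = mass_flux \<theta> (primitive M V)"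
    have mW: "m = mass_flux \<theta> (primitive M W)" unfolding m_def mass_flux_primitive eq ..
    have m0: "m \<noteq> 0" using that(4) by (simp add: m_def mass_flux_primitive)
    have rh: "pr ?z' - pr ?z = - m\<^sup>2 * (fst ?z' - fst ?z)"
      "en ?z' - en ?z + (fst ?z' - fst ?z) * (pr ?z' + pr ?z) / 2 = 0"
      using rankine_hugoniot[OF eq'] m0 spec_vol_pos VW unfolding fz m_def primitive_def by auto
    have less': "fst ?z < fst ?z'" using less fz by simp
    then have "(pr ?z' - pr ?z) / (fst ?z' - fst ?z) = - m\<^sup>2"
      using less' unfolding rh(1) by simp
    then have "entropy M W < entropy M V" "p_tau ?z < - m\<^sup>2" "- m\<^sup>2 < p_tau ?z'"
      using hugoniot_expansion[OF z less' rh(2)] by (simp_all add: thermo_state_def)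
    then show ?thesis
      unfolding char_disc_def m_def[symmetric] mW[symmetric] by (simp add: primitive_def)
  qed
  have same: "V = W" if "spec_vol V = spec_vol W"
  proof -
    let ?z = "thermo_state M V" and ?z' = "thermo_state M W"
    have z: "?z \<in> St" "?z' \<in> St" and fz: "fst ?z = spec_vol V" "fst ?z' = spec_vol W"
      using thermo_state_in_St VW by (auto simp: thermo_state_def)
    have eq': "primitive_flux \<theta> (?z, vel_x V, vel_y V) = primitive_flux \<theta> (?z', vel_x W, vel_y W)"
      using eq by (simp add: angular_flux_primitive VW primitive_def)
    have "mass_flux \<theta> (?z, vel_x V, vel_y V) \<noteq> 0"
      using m unfolding mass_flux_primitive[symmetric] by (simp add: primitive_def)
    note rh = rankine_hugoniot[OF eq' _ _ this]
    have "pr ?z' = pr ?z" "vel_x V = vel_x W" "vel_y V = vel_y W"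
      using rh(1,3) spec_vol_pos VW that unfolding fz by auto
    moreover have "?z = ?z'"
      using inj_onD[OF inj_pressure _ z] \<open>pr ?z' = pr ?z\<close> fz that by simp
    ultimately show ?thesis using inj_onD[OF inj_primitive _ VW] by (simp add: primitive_def)
  qed
  have m': "fst (angular_flux M \<theta> W) \<noteq> 0" using m eq by simp
  consider "spec_vol V < spec_vol W" | "V = W" | "spec_vol W < spec_vol V"
    using same by linarith
  note cases = this
  show "V = W" if "entropy M V = entropy M W"
    using expansion[OF VW eq m] expansion[OF VW(2,1) eq[symmetric] m'] that
    by (cases rule: cases) auto
  show "char_disc \<theta> (primitive M V) < 0 \<and> 0 < char_disc \<theta> (primitive M W)"
    if "entropy M W < entropy M V"
    using expansion[OF VW eq m] expansion[OF VW(2,1) eq[symmetric] m'] that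
    by (cases rule: cases) auto
qed

text \<open>
  Where \<open>m \<noteq> 0\<close>, the linearized flux is singular only on characteristics. For a vector
  \<open>(d\<tau>, ds, du, dv)\<close> in its kernel, mass gives \<open>dN = m d\<tau>\<close>, and momentum gives \<open>m\<^sup>2 d\<tau> + dp = 0\<close> together
  with a velocity change normal to the ray. The energy equation reduces to \<open>T ds = 0\<close>, so that
  \<open>(m\<^sup>2 + p_tau) d\<tau> = 0\<close>.
\<close>

lemma primitive_flux_derivative_injective:
  assumes z: "z \<in> St" "fst z > 0" and m: "mass_flux \<theta> (z, u, v) \<noteq> 0"
    and disc: "char_disc \<theta> (z, u, v) \<noteq> 0"
  obtains A where "(primitive_flux \<theta> has_derivative A) (at (z, u, v))" "\<And>h. A h = 0 \<Longrightarrow> h = 0"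
proof -
  let ?Z = "(z, u, v)"
  define m where "m = mass_flux \<theta> ?Z"
  have N: "u * sin \<theta> - v * cos \<theta> = m * fst z" using z by (simp add: m_def mass_flux_def)
  define m' where "m' h = (fst (snd h) * sin \<theta> - snd (snd h) * cos \<theta> - m * fst (fst h)) / fst z"
    for h :: "(real \<times> real) \<times> real \<times> real"
  define p' where "p' h = p_tau z * fst (fst h) + p_s z * snd (fst h)"
    for h :: "(real \<times> real) \<times> real \<times> real"
  define e' where "e' h = - pr z * fst (fst h) + temp z * snd (fst h)"
    for h :: "(real \<times> real) \<times> real \<times> real"
  have dm: "(mass_flux \<theta> has_derivative m') (at ?Z)"
    unfolding mass_flux_def case_prod_unfold m'_def[abs_def]
    using z N by (auto intro!: derivative_eq_intros simp: fun_eq_iff field_simps)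
  have dfst: "(fst has_derivative fst) (at ?Z)" by (rule has_derivative_fst[OF has_derivative_ident])
  define P where "P Z = pr (fst Z)" for Z :: "(real \<times> real) \<times> real \<times> real"
  define E where "E Z = en (fst Z)" for Z :: "(real \<times> real) \<times> real \<times> real"
  have dP: "(P has_derivative p') (at ?Z)"
    using has_derivative_compose[OF dfst, of pr] has_derivative_pr[OF z(1)]
    unfolding P_def[abs_def] p'_def[abs_def] by simp
  have dE: "(E has_derivative e') (at ?Z)"
    using has_derivative_compose[OF dfst, of en] has_derivative_en[OF z(1)]
    unfolding E_def[abs_def] e'_def[abs_def] by simp
  let ?H = "(u\<^sup>2 + v\<^sup>2) / 2 + en z + pr z * fst z"
  define A where "A h = (m' h, m' h * u + m * fst (snd h) + p' h * sin \<theta>,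
      m' h * v + m * snd (snd h) - p' h * cos \<theta>,
      m' h * ?H + m * (u * fst (snd h) + v * snd (snd h) + e' h + p' h * fst z + pr z * fst (fst h)))"
    for h
  have eqf: "primitive_flux \<theta> = (\<lambda>Z. (mass_flux \<theta> Z, mass_flux \<theta> Z * fst (snd Z) + P Z * sin \<theta>,
      mass_flux \<theta> Z * snd (snd Z) - P Z * cos \<theta>,
      mass_flux \<theta> Z * (((fst (snd Z))\<^sup>2 + (snd (snd Z))\<^sup>2) / 2 + E Z + P Z * fst (fst Z))))"
    by (auto simp: primitive_flux_def Let_def fun_eq_iff P_def E_def)
  have "(primitive_flux \<theta> has_derivative A) (at ?Z)"
    unfolding eqf A_def[abs_def]
    by (rule has_derivative_eq_rhs, (rule derivative_intros dm dP dE numeral_neq_zero)+)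
       (simp add: m_def[symmetric] P_def E_def fun_eq_iff algebra_simps)
  moreover have "h = 0" if "A h = 0" for h
  proof -
    obtain a b c d where h: "h = ((a, b), c, d)" by (metis prod.collapse)
    have m'0: "m' h = 0" and cd: "m * c = - p' h * sin \<theta>" "m * d = p' h * cos \<theta>"
      and "m * (u * c + v * d + e' h + p' h * fst z + pr z * a) = 0"
      using that by (auto simp: A_def h prod_eq_iff algebra_simps)
    then have e: "u * c + v * d + e' h + p' h * fst z + pr z * a = 0" using m by (simp add: m_def)
    have sc: "sin \<theta> * sin \<theta> + cos \<theta> * cos \<theta> = 1" using sin_cos_squared_add[of \<theta>] by (simp only: power2_eq_square)
    have "m * (m * a) = m * (c * sin \<theta> - d * cos \<theta>)" using m'0 z by (simp add: m'_def h)
    also have "\<dots> = (m * c) * sin \<theta> - (m * d) * cos \<theta>" by (simp add: algebra_simps)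
    also have "\<dots> = - p' h * (sin \<theta> * sin \<theta> + cos \<theta> * cos \<theta>)" unfolding cd by algebra
    finally have p: "m * (m * a) + p' h = 0" using sc by simp
    have "m * (u * c + v * d) = u * (m * c) + v * (m * d)" by (simp add: algebra_simps)
    also have "\<dots> = - p' h * (u * sin \<theta> - v * cos \<theta>)" unfolding cd by (simp add: algebra_simps)
    also have "\<dots> = m * (- p' h * fst z)" unfolding N by simp
    finally have "u * c + v * d = - p' h * fst z" using m m_def mult_left_cancel by metis
    with e have "temp z * b = 0" by (simp add: e'_def h)
    then have b: "b = 0" using eos_derivatives(5)[OF z(1)] by simp
    have "char_disc \<theta> ?Z * a = 0"
      using p b by (simp add: char_disc_def p'_def h m_def power2_eq_square algebra_simps)
    then have a: "a = 0" using disc by simp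
    then have "p' h = 0" using b by (simp add: p'_def h)
    then show ?thesis using cd m a b by (simp add: h m_def zero_prod_def)
  qed
  ultimately show ?thesis using that by blast
qed

end

section \<open>Solutions near a shock\<close>

locale steady_flow = gas +
  fixes U :: "real \<Rightarrow> state"
  assumes solution: "steady_self_similar_entropy_solution K M U"
begin

abbreviation flux_at :: "real \<Rightarrow> state" where "flux_at \<theta> \<equiv> angular_flux M \<theta> (U \<theta>)"
abbreviation flow_rate :: "real \<Rightarrow> real" where "flow_rate \<theta> \<equiv> fst (flux_at \<theta>)"
abbreviation disc_at :: "real \<Rightarrow> real" where "disc_at \<theta> \<equiv> char_disc \<theta> (primitive M (U \<theta>))"

lemma U_in_PS: "U \<theta> \<in> PS"
  and flux_increment: "\<theta>\<^sub>1 < \<theta>\<^sub>2 \<Longrightarrow> flux_at \<theta>\<^sub>2 - flux_at \<theta>\<^sub>1 =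
        (LINT \<eta>:{\<theta>\<^sub>1..\<theta>\<^sub>2}|lebesgue. cos \<eta> *\<^sub>R flux_x M (U \<eta>) + sin \<eta> *\<^sub>R flux_y M (U \<eta>))"
  and entropy_flux_increment: "\<theta>\<^sub>1 < \<theta>\<^sub>2 \<Longrightarrow>
        (sin \<theta>\<^sub>2 * entropy_flux_x M (U \<theta>\<^sub>2) - cos \<theta>\<^sub>2 * entropy_flux_y M (U \<theta>\<^sub>2))
          - (sin \<theta>\<^sub>1 * entropy_flux_x M (U \<theta>\<^sub>1) - cos \<theta>\<^sub>1 * entropy_flux_y M (U \<theta>\<^sub>1))
        \<le> (LINT \<eta>:{\<theta>\<^sub>1..\<theta>\<^sub>2}|lebesgue.
             cos \<eta> * entropy_flux_x M (U \<eta>) + sin \<eta> * entropy_flux_y M (U \<eta>))"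
  using solution unfolding steady_self_similar_entropy_solution_def angular_flux_def by blast+

lemma uniform_bound:
  obtains C where "C > 0" "\<And>\<theta>. norm (flux_x M (U \<theta>)) \<le> C" "\<And>\<theta>. norm (flux_y M (U \<theta>)) \<le> C"
    "\<And>\<theta>. \<bar>entropy_flux_x M (U \<theta>)\<bar> \<le> C" "\<And>\<theta>. \<bar>entropy_flux_y M (U \<theta>)\<bar> \<le> C"
    "\<And>\<theta>. \<bar>entropy M (U \<theta>)\<bar> \<le> C"
proof -
  let ?f = "\<lambda>V. (flux_x M V, flux_y M V, entropy_flux_x M V, entropy_flux_y M V, entropy M V)"
  have "continuous_on PS ?f" by (intro continuous_intros continuous_on_fluxes continuous_on_entropy)
  then have "compact (?f ` PS)" using compact_continuous_image compact_phase_space[OF K_gt_1] by blast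
  then have "bounded (?f ` PS)" by (rule compact_imp_bounded)
  then obtain C where C: "C > 0" "\<And>V. V \<in> PS \<Longrightarrow> norm (?f V) \<le> C"
    unfolding bounded_pos by blast
  have part: "norm (fst x) \<le> norm x" "norm (snd y) \<le> norm y"
    for x :: "'x::real_normed_vector \<times> 'y::real_normed_vector" and y :: "'v::real_normed_vector \<times> 'w::real_normed_vector"
    by (metis norm_fst_le norm_snd_le prod.collapse)+
  show ?thesis
  proof (rule that[OF C(1)])
    fix \<theta>
    let ?V = "U \<theta>"
    note b = C(2)[OF U_in_PS[of \<theta>]]
    have b1: "norm (snd (?f ?V)) \<le> C" using part(2)[of "?f ?V"] b by linarith
    have b2: "norm (snd (snd (?f ?V))) \<le> C" using part(2)[of "snd (?f ?V)"] b1 by linarith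
    have b3: "norm (snd (snd (snd (?f ?V)))) \<le> C" using part(2)[of "snd (snd (?f ?V))"] b2 by linarith
    show "norm (flux_x M ?V) \<le> C" using part(1)[of "?f ?V"] b by simp
    show "norm (flux_y M ?V) \<le> C" using part(1)[of "snd (?f ?V)"] b1 by simp
    show "\<bar>entropy_flux_x M ?V\<bar> \<le> C" using part(1)[of "snd (snd (?f ?V))"] b2 by simp
    show "\<bar>entropy_flux_y M ?V\<bar> \<le> C" using part(1)[of "snd (snd (snd (?f ?V)))"] b3 by simp
    show "\<bar>entropy M ?V\<bar> \<le> C" using part(2)[of "snd (snd (snd (?f ?V)))"] b3 by simp
  qed
qed

text \<open>
  All that a solution gives near a discontinuity. The second estimate is the first one with the
  angle in the flux frozen at \<open>s\<close>; the third is the entropy inequality, whose left-hand side is rewritten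
  using \<open>sin \<theta> \<psi>\<^sup>x - cos \<theta> \<psi>\<^sup>y = \<rho> N S\<close>.
\<close>

lemma flux_estimates:
  "\<exists>C>0. (\<forall>s t. norm (flux_at t - flux_at s) \<le> C * \<bar>t - s\<bar>) \<and>
    (\<forall>s t. norm (angular_flux M s (U t) - angular_flux M s (U s)) \<le> C * \<bar>t - s\<bar>) \<and>
    (\<forall>s t. s \<le> t \<longrightarrow>
        flow_rate t * entropy M (U t) - flow_rate s * entropy M (U s) \<le> C * (t - s)) \<and>
    (\<forall>t. \<bar>entropy M (U t)\<bar> \<le> C)"
proof -
  obtain C where C: "C > 0" "\<And>\<theta>. norm (flux_x M (U \<theta>)) \<le> C" "\<And>\<theta>. norm (flux_y M (U \<theta>)) \<le> C"
    "\<And>\<theta>. \<bar>entropy_flux_x M (U \<theta>)\<bar> \<le> C" "\<And>\<theta>. \<bar>entropy_flux_y M (U \<theta>)\<bar> \<le> C"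
    "\<And>\<theta>. \<bar>entropy M (U \<theta>)\<bar> \<le> C" using uniform_bound by blast
  have trig: "norm (c *\<^sub>R x + d *\<^sub>R y) \<le> 2 * C * e"
    if "\<bar>c\<bar> \<le> e" "\<bar>d\<bar> \<le> e" "norm x \<le> C" "norm y \<le> C"
    for c d e and x y :: "'v::real_normed_vector"
  proof -
    have "norm (c *\<^sub>R x + d *\<^sub>R y) \<le> norm (c *\<^sub>R x) + norm (d *\<^sub>R y)" by (rule norm_triangle_ineq)
    also have "\<dots> \<le> e * C + e * C"
      unfolding norm_scaleR using that by (intro add_mono mult_mono) auto
    finally show ?thesis by (simp add: algebra_simps)
  qed
  have lip_less: "norm (flux_at t - flux_at s) \<le> 2 * C * (t - s)" if "s < t" for s t
    unfolding flux_increment[OF that]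
    by (rule norm_set_lebesgue_integral_le) (use that C in \<open>auto intro!: trig[of _ 1, simplified]\<close>)
  have lip: "norm (flux_at t - flux_at s) \<le> 2 * C * \<bar>t - s\<bar>" for s t
    using lip_less[of s t] lip_less[of t s] by (cases s t rule: linorder_cases) (auto simp: norm_minus_commute)
  have frozen: "norm (angular_flux M s (U t) - angular_flux M s (U s)) \<le> 4 * C * \<bar>t - s\<bar>" for s t
  proof -
    have lipsin: "\<bar>sin s - sin t\<bar> \<le> \<bar>t - s\<bar>" "\<bar>cos t - cos s\<bar> \<le> \<bar>t - s\<bar>" for s t :: real
      using sin_cos_lipschitz[of s t] sin_cos_lipschitz[of t s] by (simp_all add: abs_minus_commute)
    have "angular_flux M s (U t) - angular_flux M s (U s) = (flux_at t - flux_at s)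
        + ((sin s - sin t) *\<^sub>R flux_x M (U t) + (cos t - cos s) *\<^sub>R flux_y M (U t))"
      by (simp add: angular_flux_def algebra_simps)
    also have "norm \<dots> \<le> 2 * C * \<bar>t - s\<bar> + 2 * C * \<bar>t - s\<bar>"
      by (rule norm_triangle_mono[OF lip trig]) (use lipsin C in auto)
    finally show ?thesis by simp
  qed
  have ent: "flow_rate t * entropy M (U t) - flow_rate s * entropy M (U s) \<le> 2 * C * (t - s)"
    if "s \<le> t" for s t
  proof (cases "s = t")
    case False
    then have st: "s < t" using that by simp
    have "sin r * entropy_flux_x M (U r) - cos r * entropy_flux_y M (U r) = flow_rate r * entropy M (U r)" for r
      by (simp add: fst_angular_flux entropy_flux_x_def entropy_flux_y_def algebra_simps)
    then have "flow_rate t * entropy M (U t) - flow_rate s * entropy M (U s) \<le>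
        (LINT \<eta>:{s..t}|lebesgue. cos \<eta> * entropy_flux_x M (U \<eta>) + sin \<eta> * entropy_flux_y M (U \<eta>))"
      using entropy_flux_increment[OF st] by simp
    also have "\<dots> \<le> norm (LINT \<eta>:{s..t}|lebesgue. cos \<eta> * entropy_flux_x M (U \<eta>) + sin \<eta> * entropy_flux_y M (U \<eta>))"
      by simp
    also have "\<dots> \<le> 2 * C * (t - s)"
    proof (rule norm_set_lebesgue_integral_le[OF that])
      show "norm (cos \<eta> * entropy_flux_x M (U \<eta>) + sin \<eta> * entropy_flux_y M (U \<eta>)) \<le> 2 * C" for \<eta>
        using trig[of "cos \<eta>" 1 "sin \<eta>" "entropy_flux_x M (U \<eta>)" "entropy_flux_y M (U \<eta>)"] C by simp
    qed
    finally show ?thesis .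
  qed simp
  show ?thesis
  proof (intro exI[of _ "4 * C"] conjI allI impI)
    show "norm (flux_at t - flux_at s) \<le> 4 * C * \<bar>t - s\<bar>" for s t
      using lip[of t s] C(1) mult_nonneg_nonneg[of C "\<bar>t - s\<bar>"] by linarith
    show "flow_rate t * entropy M (U t) - flow_rate s * entropy M (U s) \<le> 4 * C * (t - s)"
      if "s \<le> t" for s t
      using ent[OF that] C(1) that mult_nonneg_nonneg[of C "t - s"] by linarith
    show "\<bar>entropy M (U t)\<bar> \<le> 4 * C" for t using C(1) C(6)[of t] by linarith
  qed (use frozen C(1) in auto)
qed

lemma isCont_flow_rate: "isCont flow_rate \<theta>"
proof -
  obtain C where C: "\<And>s t. norm (flux_at t - flux_at s) \<le> C * \<bar>t - s\<bar>"
    using flux_estimates by auto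
  have "\<forall>\<^sub>F t in at \<theta>. norm (flux_at t - flux_at \<theta>) \<le> C * \<bar>t - \<theta>\<bar>"
    by (intro always_eventually allI C)
  moreover have "((\<lambda>t. C * \<bar>t - \<theta>\<bar>) \<longlongrightarrow> C * \<bar>\<theta> - \<theta>\<bar>) (at \<theta>)" by (intro tendsto_intros)
  ultimately have "((\<lambda>t. flux_at t - flux_at \<theta>) \<longlongrightarrow> 0) (at \<theta>)"
    by (rule Lim_null_comparison[OF _ tendsto_eq_rhs]) simp
  then have "(flux_at \<longlongrightarrow> flux_at \<theta>) (at \<theta>)" by (rule LIM_zero_cancel)
  then show ?thesis unfolding isCont_def by (rule tendsto_fst)
qed

lemma frozen_flux_tendsto: "((\<lambda>t. angular_flux M \<theta> (U t)) \<longlongrightarrow> flux_at \<theta>) (at \<theta>)"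
proof -
  obtain C where C: "\<And>s t. norm (angular_flux M s (U t) - angular_flux M s (U s)) \<le> C * \<bar>t - s\<bar>"
    using flux_estimates by auto
  have "\<forall>\<^sub>F t in at \<theta>. norm (angular_flux M \<theta> (U t) - flux_at \<theta>) \<le> C * \<bar>t - \<theta>\<bar>"
    by (intro always_eventually allI C)
  moreover have "((\<lambda>t. C * \<bar>t - \<theta>\<bar>) \<longlongrightarrow> C * \<bar>\<theta> - \<theta>\<bar>) (at \<theta>)" by (intro tendsto_intros)
  ultimately have "((\<lambda>t. angular_flux M \<theta> (U t) - flux_at \<theta>) \<longlongrightarrow> 0) (at \<theta>)"
    by (rule Lim_null_comparison[OF _ tendsto_eq_rhs]) simp
  then show ?thesis by (rule LIM_zero_cancel)
qed

text \<open>
  The sign \<open>\<epsilon>\<close> is that of the normal velocity. Entropy of the solution times \<open>\<epsilon>\<close> is one-sided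
  Lipschitz near \<open>\<theta>\<close>, so it has one-sided limits there; the flux has a limit as well. Both together
  determine the state, so by compactness the solution itself has one-sided limits. At a discontinuity
  the limits of \<open>\<epsilon> S\<close> cannot agree, because the value at \<open>\<theta>\<close> lies between them; their order decides
  which side is subsonic.
\<close>

lemma one_sided_limits:
  assumes \<epsilon>: "\<epsilon> = 1 \<or> \<epsilon> = -1" and m: "\<epsilon> * flow_rate \<theta> > 0"
  obtains l r where "l \<in> PS" "r \<in> PS" "(U \<longlongrightarrow> l) (at_left \<theta>)" "(U \<longlongrightarrow> r) (at_right \<theta>)"
    "\<not> isCont U \<theta> \<Longrightarrow> \<epsilon> * char_disc \<theta> (primitive M l) < 0 \<and> \<epsilon> * char_disc \<theta> (primitive M r) > 0"
proof -
  have \<epsilon>2: "\<epsilon> * \<epsilon> = 1" using \<epsilon> by auto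
  \<comment> \<open>A lower bound for the mass flux near \<open>\<theta>\<close>; it also keeps the states in a compact set away from \<open>m = 0\<close>,
    where flux and entropy would not determine the state.\<close>
  define \<delta> where "\<delta> = \<epsilon> * flow_rate \<theta> / 2"
  have \<delta>: "\<delta> > 0" "\<delta> < \<epsilon> * flow_rate \<theta>" using m by (auto simp: \<delta>_def)
  obtain C where C: "C > 0" "\<And>s t. norm (flux_at t - flux_at s) \<le> C * \<bar>t - s\<bar>"
    "\<And>s t. s \<le> t \<Longrightarrow> flow_rate t * entropy M (U t) - flow_rate s * entropy M (U s) \<le> C * (t - s)"
    "\<And>t. \<bar>entropy M (U t)\<bar> \<le> C" using flux_estimates by auto
  have "isCont (\<lambda>t. \<epsilon> * flow_rate t) \<theta>" by (intro continuous_intros isCont_flow_rate)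
  then have "\<forall>\<^sub>F t in nhds \<theta>. \<delta> < \<epsilon> * flow_rate t"
    using order_tendstoD(1)[OF _ \<delta>(2)] \<delta>(2) unfolding isCont_def eventually_nhds_conv_at by blast
  then obtain d where d: "d > 0" "\<And>t. dist t \<theta> < d \<Longrightarrow> \<delta> < \<epsilon> * flow_rate t"
    unfolding eventually_nhds_metric by blast
  define S where "S t = \<epsilon> * entropy M (U t)" for t
  \<comment> \<open>From \<open>m(t) (S(t) - S(s)) = [m S] - [m] S(s)\<close>: the first bracket is controlled by the entropy
    inequality, the second by the Lipschitz bound on \<open>m\<close>.\<close>
  have slip: "S t - S s \<le> (C + C * C) / \<delta> * (t - s)" if st: "\<theta> - d < s" "s \<le> t" "t < \<theta> + d" for s t
  proof (cases "S t \<le> S s")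
    case False
    have mt: "\<delta> < \<epsilon> * flow_rate t" using d(2)[of t] st by (auto simp: dist_real_def)
    have "\<delta> * (S t - S s) \<le> (\<epsilon> * flow_rate t) * (S t - S s)"
      using mt False by (intro mult_right_mono) auto
    also have "\<dots> = (\<epsilon> * \<epsilon>) * (flow_rate t * (entropy M (U t) - entropy M (U s)))"
      by (simp add: S_def algebra_simps)
    also have "\<dots> = (flow_rate t * entropy M (U t) - flow_rate s * entropy M (U s))
        + (flow_rate s - flow_rate t) * entropy M (U s)"
      unfolding \<epsilon>2 by (simp add: algebra_simps)
    also have "(flow_rate s - flow_rate t) * entropy M (U s) \<le> C * (t - s) * C"
    proof -
      have "\<bar>flow_rate s - flow_rate t\<bar> \<le> norm (flux_at s - flux_at t)"
        by (metis fst_diff norm_fst_le prod.collapse real_norm_def)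
      also have "\<dots> \<le> C * (t - s)" using C(2)[of s t] st(2) by simp
      finally have "\<bar>flow_rate s - flow_rate t\<bar> * \<bar>entropy M (U s)\<bar> \<le> C * (t - s) * C"
        using C(1,4) by (intro mult_mono) auto
      then show ?thesis by (metis abs_ge_self abs_mult order_trans)
    qed
    also have "flow_rate t * entropy M (U t) - flow_rate s * entropy M (U s) \<le> C * (t - s)"
      by (rule C(3)[OF st(2)])
    finally have "\<delta> * (S t - S s) \<le> (C + C * C) * (t - s)" by (simp add: algebra_simps)
    then show ?thesis using \<delta>(1) by (simp add: field_simps)
  next
    case True
    moreover have "(C + C * C) / \<delta> * (t - s) \<ge> 0" using C(1) \<delta>(1) st by simp
    ultimately show ?thesis by linarith
  qed
  have "\<theta> - d < \<theta>" "\<theta> < \<theta> + d" using d(1) by auto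
  then obtain L R where LR: "(S \<longlongrightarrow> L) (at_left \<theta>)" "(S \<longlongrightarrow> R) (at_right \<theta>)" "R \<le> S \<theta>" "S \<theta> \<le> L"
    by (rule one_sided_lipschitz_limits[where f = S and c = "(C + C * C) / \<delta>"]) (assumption | rule slip)+
  define A where "A = {V \<in> PS. \<delta> \<le> \<epsilon> * fst (angular_flux M \<theta> V)}"
  define \<Phi> where "\<Phi> V = (angular_flux M \<theta> V, \<epsilon> * entropy M V)" for V
  have "continuous_on PS (\<lambda>V. \<epsilon> * fst (angular_flux M \<theta> V))"
    by (intro continuous_intros continuous_on_angular_flux)
  then have "closed (PS \<inter> (\<lambda>V. \<epsilon> * fst (angular_flux M \<theta> V)) -` {\<delta>..})"
    using compact_imp_closed[OF compact_phase_space[OF K_gt_1]]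
    by (rule continuous_closed_preimage) simp
  then have "compact (PS \<inter> (PS \<inter> (\<lambda>V. \<epsilon> * fst (angular_flux M \<theta> V)) -` {\<delta>..}))"
    using compact_Int_closed compact_phase_space[OF K_gt_1] by blast
  moreover have "PS \<inter> (PS \<inter> (\<lambda>V. \<epsilon> * fst (angular_flux M \<theta> V)) -` {\<delta>..}) = A" by (auto simp: A_def)
  ultimately have A: "compact A" by simp
  have cont\<Phi>: "continuous_on A \<Phi>"
    unfolding \<Phi>_def
    by (rule continuous_on_subset[of PS])
      (auto simp: A_def intro!: continuous_intros continuous_on_angular_flux continuous_on_entropy)
  have nz: "fst (angular_flux M \<theta> V) \<noteq> 0" if "V \<in> A" for V
    using that \<delta>(1) by (auto simp: A_def)
  have inj\<Phi>: "inj_on \<Phi> A"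
  proof (rule inj_onI)
    fix V W assume VW: "V \<in> A" "W \<in> A" "\<Phi> V = \<Phi> W"
    then show "V = W"
      using equal_fluxes_entropy_order(1)[of V W \<theta>] nz[OF VW(1)] \<epsilon> by (auto simp: A_def \<Phi>_def)
  qed
  have near: "\<forall>\<^sub>F t in at \<theta>. U t \<in> A"
  proof -
    have "((\<lambda>t. \<epsilon> * fst (angular_flux M \<theta> (U t))) \<longlongrightarrow> \<epsilon> * flow_rate \<theta>) (at \<theta>)"
      by (intro tendsto_intros frozen_flux_tendsto)
    from order_tendstoD(1)[OF this \<delta>(2)] show ?thesis
      by eventually_elim (auto simp: A_def U_in_PS)
  qed
  have lim: "\<exists>x\<in>A. \<Phi> x = (flux_at \<theta>, y) \<and> (U \<longlongrightarrow> x) F"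
    if "F \<le> at \<theta>" "F \<noteq> bot" "(S \<longlongrightarrow> y) F" for F y
  proof -
    have "((\<lambda>t. \<Phi> (U t)) \<longlongrightarrow> (flux_at \<theta>, y)) F"
      using tendsto_Pair[OF tendsto_mono[OF that(1) frozen_flux_tendsto] that(3)]
      unfolding \<Phi>_def S_def[abs_def] .
    then show ?thesis
      using compact_injective_tendsto[OF A cont\<Phi> inj\<Phi> filter_leD[OF that(1) near] _ that(2)] by blast
  qed
  obtain l where l: "l \<in> A" "\<Phi> l = (flux_at \<theta>, L)" "(U \<longlongrightarrow> l) (at_left \<theta>)"
    using lim[OF at_le _ LR(1)] by auto
  obtain r where r: "r \<in> A" "\<Phi> r = (flux_at \<theta>, R)" "(U \<longlongrightarrow> r) (at_right \<theta>)"
    using lim[OF at_le _ LR(2)] by auto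
  have "\<epsilon> * char_disc \<theta> (primitive M l) < 0 \<and> \<epsilon> * char_disc \<theta> (primitive M r) > 0"
    if nc: "\<not> isCont U \<theta>"
  proof -
    have "L \<noteq> R"
    proof
      assume "L = R"
      then have "L = S \<theta>" "R = S \<theta>" using LR by auto
      then have "(S \<longlongrightarrow> S \<theta>) (at \<theta>)" using LR by (simp add: filterlim_at_split)
      then obtain x where x: "x \<in> A" "\<Phi> x = (flux_at \<theta>, S \<theta>)" "(U \<longlongrightarrow> x) (at \<theta>)"
        using lim[OF order_refl at_neq_bot] by blast
      moreover have "U \<theta> \<in> A" using \<delta>(2) by (simp add: A_def U_in_PS)
      ultimately have "x = U \<theta>" using inj_onD[OF inj\<Phi>, of x "U \<theta>"] by (simp add: \<Phi>_def S_def)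
      then show False using nc x(3) by (simp add: isCont_def)
    qed
    then have less: "\<epsilon> * entropy M r < \<epsilon> * entropy M l"
      using LR(3,4) l(2) r(2) by (simp add: \<Phi>_def)
    have PS: "l \<in> PS" "r \<in> PS" and eq: "angular_flux M \<theta> l = angular_flux M \<theta> r"
      using l r by (auto simp: A_def \<Phi>_def)
    note order = equal_fluxes_entropy_order(2)[OF PS eq nz[OF l(1)]]
      equal_fluxes_entropy_order(2)[OF PS(2,1) eq[symmetric] nz[OF r(1)]]
    from \<epsilon> show ?thesis
      by (elim disjE) (use less order in auto)
  qed
  then show ?thesis using that[of l r] l r by (auto simp: A_def)
qed

lemma disc_tendsto:
  assumes U: "(U \<longlongrightarrow> l) F" and l: "l \<in> PS" and F: "F \<le> at \<theta>"
  shows "(disc_at \<longlongrightarrow> char_disc \<theta> (primitive M l)) F"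
proof -
  have id: "((\<lambda>t. t) \<longlongrightarrow> \<theta>) F" by (rule tendsto_mono[OF F]) (rule tendsto_ident_at)
  have lim: "((\<lambda>t. f (U t)) \<longlongrightarrow> f l) F" if "continuous_on PS f" for f :: "state \<Rightarrow> 'x::topological_space"
    by (rule continuous_on_tendsto_compose[OF that U l]) (simp add: U_in_PS)
  have "continuous_on PS (\<lambda>V. p_tau (thermo_state M V))"
    by (rule continuous_on_compose2[OF continuous_on_p_tau continuous_on_thermo_state])
       (use thermo_state_in_St in auto)
  then show ?thesis
    unfolding char_disc_def mass_flux_primitive fst_angular_flux
    unfolding primitive_def fst_conv
    by (intro tendsto_intros id lim continuous_on_components PS_density)
qed

text \<open>
  Fix an angle \<open>t\<close>. As a function of \<open>r\<close>, the flux of \<open>U r\<close> through the fixed ray at angle \<open>t\<close> has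
  derivative 0 at \<open>t\<close>: the balance law gives \<open>cos t f\<^sup>x + sin t f\<^sup>y\<close> as the derivative of the flux
  through the moving ray, which is precisely what the rotation of the ray contributes. Where
  \<open>m\<close> and the discriminant do not vanish, the linearized flux is injective, so the primitive variables have
  derivative 0 as well.
\<close>

lemma locally_constant:
  assumes J: "open J" "is_interval J" and cont: "\<And>\<theta>. \<theta> \<in> J \<Longrightarrow> isCont U \<theta>"
    and m: "\<And>\<theta>. \<theta> \<in> J \<Longrightarrow> flow_rate \<theta> \<noteq> 0" and disc: "\<And>\<theta>. \<theta> \<in> J \<Longrightarrow> disc_at \<theta> \<noteq> 0"
  shows "U constant_on J"
proof -
  have contU: "continuous_on J U" using cont continuous_at_imp_continuous_on by blast
  have comp: "continuous_on J (\<lambda>t. f (U t))" if "continuous_on PS f" for f :: "state \<Rightarrow> 'x::topological_space"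
    by (rule continuous_on_compose2[OF that contU]) (use U_in_PS in auto)
  have "((\<lambda>t. primitive M (U t)) has_vector_derivative 0) (at t)" if t: "t \<in> J" for t
  proof -
    have isC: "isCont (\<lambda>t. f (U t)) t" if "continuous_on PS f" for f :: "state \<Rightarrow> 'x::topological_space"
      using comp[OF that] J(1) t by (simp add: continuous_on_eq_continuous_at)
    have "(flux_at has_vector_derivative
        (cos t *\<^sub>R flux_x M (U t) + sin t *\<^sub>R flux_y M (U t))) (at t)"
      by (rule has_vector_derivative_from_integral_increments[OF flux_increment J t])
         (auto intro!: continuous_intros comp continuous_on_fluxes)
    moreover have "((\<lambda>r. (sin t - sin r) *\<^sub>R flux_x M (U r)) has_vector_derivative
        (- cos t) *\<^sub>R flux_x M (U t)) (at t)"
      by (rule has_vector_derivative_vanishing_scaleR)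
         (auto intro!: derivative_eq_intros isC continuous_on_fluxes)
    moreover have "((\<lambda>r. (cos r - cos t) *\<^sub>R flux_y M (U r)) has_vector_derivative
        (- sin t) *\<^sub>R flux_y M (U t)) (at t)"
      by (rule has_vector_derivative_vanishing_scaleR)
         (auto intro!: derivative_eq_intros isC continuous_on_fluxes)
    ultimately have "((\<lambda>r. flux_at r + (sin t - sin r) *\<^sub>R flux_x M (U r) + (cos r - cos t) *\<^sub>R flux_y M (U r))
        has_vector_derivative
        cos t *\<^sub>R flux_x M (U t) + sin t *\<^sub>R flux_y M (U t)
          + (- cos t) *\<^sub>R flux_x M (U t) + (- sin t) *\<^sub>R flux_y M (U t)) (at t)"
      by (intro has_vector_derivative_add)
    moreover have "flux_at r + (sin t - sin r) *\<^sub>R flux_x M (U r) + (cos r - cos t) *\<^sub>R flux_y M (U r)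
        = primitive_flux t (primitive M (U r))" for r
      unfolding angular_flux_primitive[OF U_in_PS, symmetric]
      by (simp add: angular_flux_def algebra_simps)
    ultimately have zero: "((\<lambda>r. primitive_flux t (primitive M (U r))) has_vector_derivative 0) (at t)"
      by simp
    have z: "thermo_state M (U t) \<in> St" "fst (thermo_state M (U t)) > 0"
      using thermo_state_in_St[OF U_in_PS] spec_vol_pos[OF U_in_PS] by (auto simp: thermo_state_def)
    obtain A where A: "(primitive_flux t has_derivative A) (at (primitive M (U t)))" "\<And>h. A h = 0 \<Longrightarrow> h = 0"
      using primitive_flux_derivative_injective[OF z, of t "vel_x (U t)" "vel_y (U t)"] m[OF t] disc[OF t]
      unfolding mass_flux_primitive[symmetric] primitive_def by blast
    show ?thesis
      by (rule has_vector_derivative_zero_through_injective_derivative[OF A(1) A(2) _ zero])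
         (auto intro: isC continuous_on_primitive)
  qed
  then obtain c where "\<And>t. t \<in> J \<Longrightarrow> primitive M (U t) = c"
    using has_vector_derivative_zero_constant[of J "\<lambda>t. primitive M (U t)"] J(2)
    by (meson has_vector_derivative_at_within is_interval_convex)
  then show ?thesis
    unfolding constant_on_def using inj_onD[OF inj_primitive _ U_in_PS U_in_PS] by metis
qed

text \<open>
  Just to the right of the jump the discriminant has the sign it has in the right limit, by
  continuity. A further discontinuity there would have a left limit whose discriminant has the opposite
  sign, so there is none, and the solution is constant. The left side is the mirror image.
\<close>

lemma constant_beside_shock:
  assumes \<epsilon>: "\<epsilon> = 1 \<or> \<epsilon> = -1" and N: "\<forall>\<^sub>F \<theta> in nhds \<theta>\<^sub>0. \<epsilon> * normal_velocity U \<theta> > 0"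
    and jump: "\<not> isCont U \<theta>\<^sub>0"
  shows "(\<exists>\<sigma>\<^sub>p \<sigma>\<^sub>m. \<sigma>\<^sub>p > \<theta>\<^sub>0 \<and> \<sigma>\<^sub>m < \<theta>\<^sub>0 \<and>
            U constant_on {\<sigma>\<^sub>m<..<\<theta>\<^sub>0} \<and> U constant_on {\<theta>\<^sub>0<..<\<sigma>\<^sub>p}) \<and>
         (\<exists>l. (U \<longlongrightarrow> l) (at_left \<theta>\<^sub>0)) \<and> (\<exists>r. (U \<longlongrightarrow> r) (at_right \<theta>\<^sub>0))"
proof -
  have rate: "flow_rate \<theta> = density (U \<theta>) * normal_velocity U \<theta>" for \<theta>
    by (simp add: fst_angular_flux normal_velocity_def)
  have "\<forall>\<^sub>F \<theta> in nhds \<theta>\<^sub>0. \<epsilon> * flow_rate \<theta> > 0"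
    using N
  proof eventually_elim
    case (elim \<theta>)
    then have "density (U \<theta>) * (\<epsilon> * normal_velocity U \<theta>) > 0"
      using density_pos[OF K_gt_1 U_in_PS] by simp
    then show ?case unfolding rate by (simp add: mult.left_commute)
  qed
  then obtain d where d: "d > 0" "\<And>\<theta>. dist \<theta> \<theta>\<^sub>0 < d \<Longrightarrow> \<epsilon> * flow_rate \<theta> > 0"
    unfolding eventually_nhds_metric by blast
  have rate_pos: "\<epsilon> * flow_rate \<theta> > 0" if "\<theta>\<^sub>0 - d < \<theta>" "\<theta> < \<theta>\<^sub>0 + d" for \<theta>
    by (rule d(2)) (use that in \<open>auto simp: dist_real_def\<close>)
  obtain l r where lr: "l \<in> PS" "r \<in> PS" "(U \<longlongrightarrow> l) (at_left \<theta>\<^sub>0)" "(U \<longlongrightarrow> r) (at_right \<theta>\<^sub>0)"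
    "\<epsilon> * char_disc \<theta>\<^sub>0 (primitive M l) < 0" "\<epsilon> * char_disc \<theta>\<^sub>0 (primitive M r) > 0"
    using one_sided_limits[OF \<epsilon> rate_pos[of \<theta>\<^sub>0]] jump d(1) by (metis add_less_same_cancel1 diff_add_cancel less_add_same_cancel1)
  have disc_sided: "((\<lambda>t. \<epsilon> * disc_at t) \<longlongrightarrow> \<epsilon> * char_disc \<theta> (primitive M x)) F"
    if "(U \<longlongrightarrow> x) F" "x \<in> PS" "F \<le> at \<theta>" for x F \<theta>
    by (intro tendsto_intros disc_tendsto that)
  have "\<forall>\<^sub>F t in at_right \<theta>\<^sub>0. \<epsilon> * disc_at t > 0"
    using order_tendstoD(1)[OF disc_sided[OF lr(4,2) at_le] lr(6)] by simp
  then obtain b where b: "b > \<theta>\<^sub>0" "\<And>t. \<theta>\<^sub>0 < t \<Longrightarrow> t < b \<Longrightarrow> \<epsilon> * disc_at t > 0"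
    unfolding eventually_at_right_field by blast
  have "\<forall>\<^sub>F t in at_left \<theta>\<^sub>0. \<epsilon> * disc_at t < 0"
    using order_tendstoD(2)[OF disc_sided[OF lr(3,1) at_le] lr(5)] by simp
  then obtain a where a: "a < \<theta>\<^sub>0" "\<And>t. a < t \<Longrightarrow> t < \<theta>\<^sub>0 \<Longrightarrow> \<epsilon> * disc_at t < 0"
    unfolding eventually_at_left_field by blast
  define \<sigma>\<^sub>p \<sigma>\<^sub>m where "\<sigma>\<^sub>p = min b (\<theta>\<^sub>0 + d)" and "\<sigma>\<^sub>m = max a (\<theta>\<^sub>0 - d)"
  have \<sigma>: "\<sigma>\<^sub>p > \<theta>\<^sub>0" "\<sigma>\<^sub>m < \<theta>\<^sub>0" using a b d(1) by (auto simp: \<sigma>\<^sub>p_def \<sigma>\<^sub>m_def)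
  have "U constant_on {\<theta>\<^sub>0<..<\<sigma>\<^sub>p}"
  proof (rule locally_constant)
    fix t assume t: "t \<in> {\<theta>\<^sub>0<..<\<sigma>\<^sub>p}"
    have rt: "\<epsilon> * flow_rate t > 0" using t d(1) by (intro rate_pos) (auto simp: \<sigma>\<^sub>p_def)
    then show "flow_rate t \<noteq> 0" by auto
    show "disc_at t \<noteq> 0" using b(2)[of t] t by (auto simp: \<sigma>\<^sub>p_def)
    show "isCont U t"
    proof (rule ccontr)
      assume "\<not> isCont U t"
      with one_sided_limits[OF \<epsilon> rt] obtain x where x: "x \<in> PS" "(U \<longlongrightarrow> x) (at_left t)"
        "\<epsilon> * char_disc t (primitive M x) < 0" by metis
      have "\<forall>\<^sub>F r in at_left t. \<epsilon> * disc_at r < 0"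
        using order_tendstoD(2)[OF disc_sided[OF x(2,1) at_le] x(3)] by simp
      moreover have "\<forall>\<^sub>F r in at_left t. r \<in> {\<theta>\<^sub>0<..<t}" using eventually_at_left_real[of \<theta>\<^sub>0 t] t by simp
      ultimately have "\<forall>\<^sub>F r in at_left t. False"
      proof eventually_elim
        case (elim q)
        then show False using b(2)[of q] t by (auto simp: \<sigma>\<^sub>p_def)
      qed
      then show False by simp
    qed
  qed (auto simp: is_interval_oo)
  moreover have "U constant_on {\<sigma>\<^sub>m<..<\<theta>\<^sub>0}"
  proof (rule locally_constant)
    fix t assume t: "t \<in> {\<sigma>\<^sub>m<..<\<theta>\<^sub>0}"
    have rt: "\<epsilon> * flow_rate t > 0" using t d(1) by (intro rate_pos) (auto simp: \<sigma>\<^sub>m_def)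
    then show "flow_rate t \<noteq> 0" by auto
    show "disc_at t \<noteq> 0" using a(2)[of t] t by (auto simp: \<sigma>\<^sub>m_def)
    show "isCont U t"
    proof (rule ccontr)
      assume "\<not> isCont U t"
      with one_sided_limits[OF \<epsilon> rt] obtain x where x: "x \<in> PS" "(U \<longlongrightarrow> x) (at_right t)"
        "\<epsilon> * char_disc t (primitive M x) > 0" by metis
      have "\<forall>\<^sub>F r in at_right t. \<epsilon> * disc_at r > 0"
        using order_tendstoD(1)[OF disc_sided[OF x(2,1) at_le] x(3)] by simp
      moreover have "\<forall>\<^sub>F r in at_right t. r \<in> {t<..<\<theta>\<^sub>0}" using eventually_at_right_real[of t \<theta>\<^sub>0] t by simp
      ultimately have "\<forall>\<^sub>F r in at_right t. False"
      proof eventually_elim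
        case (elim q)
        then show False using a(2)[of q] t by (auto simp: \<sigma>\<^sub>m_def)
      qed
      then show False by simp
    qed
  qed (auto simp: is_interval_oo)
  ultimately show ?thesis using \<sigma> lr(3,4) by blast
qed

end

theorem theorem2:
  fixes K :: real and M :: eos and U :: "real \<Rightarrow> state" and \<theta>\<^sub>0 :: real
  assumes "K > 1"
    and "admissible_eos K M"
    and "steady_self_similar_entropy_solution K M U"
    and "shock U \<theta>\<^sub>0"
  shows "(\<exists>\<sigma>\<^sub>p \<sigma>\<^sub>m. \<sigma>\<^sub>p > \<theta>\<^sub>0 \<and> \<sigma>\<^sub>m < \<theta>\<^sub>0 \<and>
            U constant_on {\<sigma>\<^sub>m<..<\<theta>\<^sub>0} \<and> U constant_on {\<theta>\<^sub>0<..<\<sigma>\<^sub>p}) \<and>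
         (\<exists>l. (U \<longlongrightarrow> l) (at_left \<theta>\<^sub>0)) \<and> (\<exists>r. (U \<longlongrightarrow> r) (at_right \<theta>\<^sub>0))"
proof -
  interpret steady_flow K M U by unfold_locales (fact assms)+
  from assms(4) show ?thesis
    unfolding shock_def forward_shock_def backward_shock_def
    using constant_beside_shock[of 1 \<theta>\<^sub>0] constant_beside_shock[of "-1" \<theta>\<^sub>0] by auto
qed

end
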